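(* Let $f\in Z^2(\operatorname{Der}_k(A),A)$, let $(\tilde L,\tilde\alpha,\tilde\pi,[,],D)$ be a $D$-Lie algebra (relative to $f$, so $\tilde\alpha:\tilde L\to D^1(A,f)$) and let $(L,\alpha)$ be the canonical quotient $A/k$-Lie-Rinehart algebra of $\tilde L$. Assume $L$ is projective as left $A$-module. Then there is an isomorphism $\tilde L\cong L(f^{\alpha})$ of $D$-Lie algebras. Hence $\tilde L$ is uniquely determined up to isomorphism by the canonical quotient $(L,\alpha)$ and the class of the 2-cocycle $f$ in $H^2(\operatorname{Der}_k(A),A)$.
   Context: $k$ is a commutative unital ring and $A$ a commutative unital $k$-algebra. $I$ is the kernel of the multiplication $A\otimes_k A\to A$ and $P:=A\otimes_k A/I^2$. A left $P$-module is a left $A\otimes_k A$-module annihilated by $I^2$; write $cu:=(c\otimes 1)u$, $uc:=(1\otimes c)u$ and $dc:=1\otimes c-c\otimes 1$, so $dc\cdot u=uc-cu$. $\operatorname{Der}_k(A)$ is a $P$-module with $xc:=cx$. An $A/k$-Lie-Rinehart algebra $(L,\alpha)$ is a $k$-Lie algebra and left $A$-module $L$ with an $A$-linear map of $k$-Lie algebras $\alpha:L\to\operatorname{Der}_k(A)$ such that $[x,ay]=a[x,y]+\alpha(x)(a)y$. $C^p(L,A)=\operatorname{Hom}_A(\wedge^p_A L,A)$ is the Lie-Rinehart complex, with $Z^p(L,A)$ and $H^p(L,A)$ its cocycles and cohomology; $\operatorname{Der}_k(A)$ is a Lie-Rinehart algebra with the identity anchor. For $f\in Z^2(\operatorname{Der}_k(A),A)$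 let $f^{\alpha}(x,y):=f(\alpha(x),\alpha(y))\in Z^2(L,A)$. $D^1(A,f):=A\oplus\operatorname{Der}_k(A)$ with $[(a,x),(b,y)]:=(x(b)-y(a)+f(x,y),[x,y])$, $c(a,x):=(ca,cx)$, $(a,x)c:=(ac+x(c),cx)$ and $\pi(a,x):=x$; it is a $k$-Lie algebra and left $P$-module. A $D$-Lie algebra (relative to $f$) is a 5-tuple $(\tilde L,\tilde\alpha,\tilde\pi,[,],D)$ where $\tilde L$ is a $k$-Lie algebra and left $P$-module, $\tilde\alpha:\tilde L\to D^1(A,f)$ and $\tilde\pi:\tilde L\to\operatorname{Der}_k(A)$ are maps of $P$-modules and $k$-Lie algebras with $\tilde\pi=\pi\circ\tilde\alpha$, $[u,av]=a[u,v]+\tilde\pi(u)(a)v$, $da\cdot u=\tilde\pi(u)(a)D$ for all $u,v\in\tilde L$, $a\in A$, and $D\in\tilde L$ is a central element with $\tilde\pi(D)=0$. A map of $D$-Lie algebras $\phi:\tilde L\to\tilde L'$ is a map of left $P$-modules and $k$-Lie algebras with $\phi(D)=D'$ and $\tilde\pi=\tilde\pi'\circ\phi$. The canonical quotient of $\tilde L$ is $L:=\tilde L/J$, where $J:=\{aD: a\in A\}$, with anchor $\alpha:L\to\operatorname{Der}_k(A)$ (also denoted $\pi_L$) induced by $\tilde\pi$; it is an $A/k$-Lie-Rinehart algebra. For an $A/k$-Lie-Rinehart algebra $(L,\alpha)$, $L(f^{\alpha}):=Az\oplus L$, elements written $(a,x)$, is the $D$-Lie algebra with $[(a,x),(b,y)]:=(\alpha(x)(b)-\alpha(y)(a)+f^{\alpha}(x,y),[x,y])$,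 $c(a,x):=(ca,cx)$, $(a,x)c:=(ac+\alpha(x)(c),cx)$, $\tilde\alpha(a,x):=(a,\alpha(x))\in D^1(A,f)$, $\tilde\pi(a,x):=\alpha(x)$ and central element $z:=(1,0)$.
   Formalization: The formal theorem additionally assumes that the structure map sends D to (1,0) in D^1(A,f), for every D-Lie algebra involved; without this the claim fails, e.g. for the zero D-Lie algebra with D=0 when A is nonzero. *)

theory Defs
  imports "HOL-Algebra.Ideal_Product" "HOL-Algebra.QuotRing" "HOL-Algebra.Module"
    "HOL-Algebra.Free_Abelian_Groups"
begin

section \<open>The algebra \<open>A \<otimes>\<^sub>k A\<close> and modules over \<open>P = A \<otimes>\<^sub>k A / I\<^sup>2\<close>\<close>

type_synonym 'a tensor = "('a \<times> 'a \<Rightarrow>\<^sub>0 int) set"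

text \<open>The monoid ring over the integers of the multiplicative monoid of \<open>A \<times> A\<close>.\<close>

definition pair_ring :: "('k, 'a) module \<Rightarrow> ('a \<times> 'a \<Rightarrow>\<^sub>0 int) ring" where
  "pair_ring A =
    \<lparr>carrier = {x. Poly_Mapping.keys x \<subseteq> carrier A \<times> carrier A},
     monoid.mult = (\<lambda>x y. frag_extend (\<lambda>(a, b). frag_extend (\<lambda>(c, d).
               frag_of (a \<otimes>\<^bsub>A\<^esub> c, b \<otimes>\<^bsub>A\<^esub> d)) y) x),
     one = frag_of (\<one>\<^bsub>A\<^esub>, \<one>\<^bsub>A\<^esub>), ring.zero = 0, add = (+)\<rparr>"

definition tensor_relations :: "'k ring \<Rightarrow> ('k, 'a) module \<Rightarrow> ('a \<times> 'a \<Rightarrow>\<^sub>0 int) set" where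
  "tensor_relations K A =
     {frag_of (a \<oplus>\<^bsub>A\<^esub> a', b) - frag_of (a, b) - frag_of (a', b) | a a' b.
        a \<in> carrier A \<and> a' \<in> carrier A \<and> b \<in> carrier A} \<union>
     {frag_of (a, b \<oplus>\<^bsub>A\<^esub> b') - frag_of (a, b) - frag_of (a, b') | a b b'.
        a \<in> carrier A \<and> b \<in> carrier A \<and> b' \<in> carrier A} \<union>
     {frag_of (c \<odot>\<^bsub>A\<^esub> a, b) - frag_of (a, c \<odot>\<^bsub>A\<^esub> b) | c a b.
        c \<in> carrier K \<and> a \<in> carrier A \<and> b \<in> carrier A}"

text \<open>The subgroup generated by the relations is stable under multiplication by pairs, so it is
  the ideal they generate, and the quotient ring is the tensor product of algebras.\<close>

definition tensor_ideal :: "'k ring \<Rightarrow> ('k, 'a) module \<Rightarrow> ('a \<times> 'a \<Rightarrow>\<^sub>0 int) set" where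
  "tensor_ideal K A = Idl\<^bsub>pair_ring A\<^esub> (tensor_relations K A)"

definition tensor_ring :: "'k ring \<Rightarrow> ('k, 'a) module \<Rightarrow> 'a tensor ring" where
  "tensor_ring K A = pair_ring A Quot tensor_ideal K A"

definition tens :: "'k ring \<Rightarrow> ('k, 'a) module \<Rightarrow> 'a \<Rightarrow> 'a \<Rightarrow> 'a tensor" where
  "tens K A a b = tensor_ideal K A +>\<^bsub>pair_ring A\<^esub> frag_of (a, b)"

text \<open>For commuting left and right actions of \<open>A\<close> on an abelian group \<open>G\<close> (written
  multiplicatively) that agree on \<open>k\<close>, the induced action of \<open>A \<otimes>\<^sub>k A\<close>, i.e.
  \<open>(a \<otimes> b) u = a (u b)\<close>. An element of \<open>A \<otimes>\<^sub>k A\<close> is a coset, all of whose representatives act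
  in the same way.\<close>

definition tensor_act ::
    "('m, 'z) monoid_scheme \<Rightarrow> ('a \<Rightarrow> 'm \<Rightarrow> 'm) \<Rightarrow> ('m \<Rightarrow> 'a \<Rightarrow> 'm) \<Rightarrow> 'a tensor \<Rightarrow> 'm \<Rightarrow> 'm" where
  "tensor_act G l r t u =
     the_elem ((\<lambda>x. finprod G (\<lambda>(a, b). l a (r u b) [^]\<^bsub>G\<^esub> Poly_Mapping.lookup x (a, b))
                      (Poly_Mapping.keys x)) ` t)"

definition mult_map :: "('k, 'a) module \<Rightarrow> 'a tensor \<Rightarrow> 'a" where
  "mult_map A t = tensor_act (add_monoid A) (\<otimes>\<^bsub>A\<^esub>) (\<otimes>\<^bsub>A\<^esub>) t \<one>\<^bsub>A\<^esub>"

definition diag_ideal :: "'k ring \<Rightarrow> ('k, 'a) module \<Rightarrow> 'a tensor set" where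
  "diag_ideal K A = a_kernel (tensor_ring K A) A (mult_map A)"

definition P_module :: "'k ring \<Rightarrow> ('k, 'a) module \<Rightarrow> ('a tensor, 'm, 'x) module_scheme \<Rightarrow> bool" where
  "P_module K A M \<longleftrightarrow>
     module (tensor_ring K A) M \<and>
     (\<forall>t \<in> ideal_prod (tensor_ring K A) (diag_ideal K A) (diag_ideal K A).
        \<forall>u \<in> carrier M. t \<odot>\<^bsub>M\<^esub> u = \<zero>\<^bsub>M\<^esub>)"

definition tens_diff :: "'k ring \<Rightarrow> ('k, 'a) module \<Rightarrow> 'a \<Rightarrow> 'a tensor" where
  "tens_diff K A c = tens K A \<one>\<^bsub>A\<^esub> c \<ominus>\<^bsub>tensor_ring K A\<^esub> tens K A c \<one>\<^bsub>A\<^esub>"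


section \<open>Modules with a bracket\<close>

text \<open>The multiplicative fields inherited from the ring record play no role.\<close>

record ('r, 'm) bracket_module = "('r, 'm) module" +
  bracket :: "'m \<Rightarrow> 'm \<Rightarrow> 'm"

definition restrict_scalars ::
    "('s \<Rightarrow> 'r) \<Rightarrow> ('r, 'm, 'x) bracket_module_scheme \<Rightarrow> ('s, 'm) bracket_module" where
  "restrict_scalars h M =
    \<lparr>carrier = carrier M, monoid.mult = monoid.mult M, one = \<one>\<^bsub>M\<^esub>, ring.zero = \<zero>\<^bsub>M\<^esub>, add = add M,
     smult = (\<lambda>s. smult M (h s)), bracket = bracket M\<rparr>"

definition lie_algebra :: "'k ring \<Rightarrow> ('k, 'm, 'x) bracket_module_scheme \<Rightarrow> bool" where
  "lie_algebra K M \<longleftrightarrow>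
     module K M \<and>
     (\<forall>x \<in> carrier M. \<forall>y \<in> carrier M. bracket M x y \<in> carrier M) \<and>
     (\<forall>x \<in> carrier M. \<forall>y \<in> carrier M. \<forall>z \<in> carrier M.
        bracket M (x \<oplus>\<^bsub>M\<^esub> y) z = bracket M x z \<oplus>\<^bsub>M\<^esub> bracket M y z \<and>
        bracket M x (y \<oplus>\<^bsub>M\<^esub> z) = bracket M x y \<oplus>\<^bsub>M\<^esub> bracket M x z) \<and>
     (\<forall>c \<in> carrier K. \<forall>x \<in> carrier M. \<forall>y \<in> carrier M.
        bracket M (c \<odot>\<^bsub>M\<^esub> x) y = c \<odot>\<^bsub>M\<^esub> bracket M x y \<and>
        bracket M x (c \<odot>\<^bsub>M\<^esub> y) = c \<odot>\<^bsub>M\<^esub> bracket M x y) \<and>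
     (\<forall>x \<in> carrier M. bracket M x x = \<zero>\<^bsub>M\<^esub>) \<and>
     (\<forall>x \<in> carrier M. \<forall>y \<in> carrier M. \<forall>z \<in> carrier M.
        bracket M x (bracket M y z) \<oplus>\<^bsub>M\<^esub> bracket M y (bracket M z x) \<oplus>\<^bsub>M\<^esub>
        bracket M z (bracket M x y) = \<zero>\<^bsub>M\<^esub>)"

definition mod_hom ::
    "('r, 'q) ring_scheme \<Rightarrow> ('r, 'm, 'x) module_scheme \<Rightarrow> ('r, 'n, 'y) module_scheme \<Rightarrow> ('m \<Rightarrow> 'n) set"
  where
  "mod_hom R M N =
     {\<phi> \<in> carrier M \<rightarrow> carrier N.
        (\<forall>x \<in> carrier M. \<forall>y \<in> carrier M. \<phi> (x \<oplus>\<^bsub>M\<^esub> y) = \<phi> x \<oplus>\<^bsub>N\<^esub> \<phi> y) \<and>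
        (\<forall>r \<in> carrier R. \<forall>x \<in> carrier M. \<phi> (r \<odot>\<^bsub>M\<^esub> x) = r \<odot>\<^bsub>N\<^esub> \<phi> x)}"

definition lie_mod_hom ::
    "('r, 'q) ring_scheme \<Rightarrow> ('r, 'm, 'x) bracket_module_scheme \<Rightarrow>
     ('r, 'n, 'y) bracket_module_scheme \<Rightarrow> ('m \<Rightarrow> 'n) set" where
  "lie_mod_hom R M N =
     {\<phi> \<in> mod_hom R M N.
        \<forall>x \<in> carrier M. \<forall>y \<in> carrier M. \<phi> (bracket M x y) = bracket N (\<phi> x) (\<phi> y)}"

definition free_module :: "('r, 'q) ring_scheme \<Rightarrow> 'x set \<Rightarrow> ('r, 'x \<Rightarrow> 'r) module" where
  "free_module R X =
    \<lparr>carrier = {g. (\<forall>x. g x \<in> carrier R) \<and> finite {x. g x \<noteq> \<zero>\<^bsub>R\<^esub>} \<and> {x. g x \<noteq> \<zero>\<^bsub>R\<^esub>} \<subseteq> X},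
     monoid.mult = undefined, one = undefined,
     ring.zero = (\<lambda>x. \<zero>\<^bsub>R\<^esub>), add = (\<lambda>g h x. g x \<oplus>\<^bsub>R\<^esub> h x), smult = (\<lambda>r g x. r \<otimes>\<^bsub>R\<^esub> g x)\<rparr>"

text \<open>Projective: a direct summand of a free module. Bases indexed by subsets of the type of
  elements of \<open>M\<close> are enough, since \<open>M\<close> is a quotient of the free module on its own carrier.\<close>

definition projective_module :: "('r, 'q) ring_scheme \<Rightarrow> ('r, 'm, 'x) module_scheme \<Rightarrow> bool" where
  "projective_module R M \<longleftrightarrow>
     module R M \<and>
     (\<exists>(X :: 'm set) i p. i \<in> mod_hom R M (free_module R X) \<and> p \<in> mod_hom R (free_module R X) M \<and>
        (\<forall>x \<in> carrier M. p (i x) = x))"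


section \<open>Lie-Rinehart algebras and their cohomology in degree two\<close>

record ('a, 'l) lie_rinehart = "('a, 'l) bracket_module" +
  anchor :: "'l \<Rightarrow> 'a \<Rightarrow> 'a"

definition derivations :: "'k ring \<Rightarrow> ('k, 'a) module \<Rightarrow> ('a \<Rightarrow> 'a) set" where
  "derivations K A =
     {x \<in> carrier A \<rightarrow>\<^sub>E carrier A.
        (\<forall>a \<in> carrier A. \<forall>b \<in> carrier A. x (a \<oplus>\<^bsub>A\<^esub> b) = x a \<oplus>\<^bsub>A\<^esub> x b) \<and>
        (\<forall>c \<in> carrier K. \<forall>a \<in> carrier A. x (c \<odot>\<^bsub>A\<^esub> a) = c \<odot>\<^bsub>A\<^esub> x a) \<and>
        (\<forall>a \<in> carrier A. \<forall>b \<in> carrier A. x (a \<otimes>\<^bsub>A\<^esub> b) = a \<otimes>\<^bsub>A\<^esub> x b \<oplus>\<^bsub>A\<^esub> x a \<otimes>\<^bsub>A\<^esub> b)}"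

definition Der :: "'k ring \<Rightarrow> ('k, 'a) module \<Rightarrow> ('a, 'a \<Rightarrow> 'a) lie_rinehart" where
  "Der K A =
    \<lparr>carrier = derivations K A, monoid.mult = undefined, one = undefined,
     ring.zero = (\<lambda>a \<in> carrier A. \<zero>\<^bsub>A\<^esub>),
     add = (\<lambda>x y. \<lambda>a \<in> carrier A. x a \<oplus>\<^bsub>A\<^esub> y a),
     smult = (\<lambda>c x. \<lambda>a \<in> carrier A. c \<otimes>\<^bsub>A\<^esub> x a),
     bracket = (\<lambda>x y. \<lambda>a \<in> carrier A. x (y a) \<ominus>\<^bsub>A\<^esub> y (x a)),
     anchor = (\<lambda>x. x)\<rparr>"

text \<open>As \<open>x c = c x\<close> on derivations, \<open>a \<otimes> b\<close> acts on them as \<open>a b\<close>.\<close>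

definition Der_P :: "'k ring \<Rightarrow> ('k, 'a) module \<Rightarrow> ('a tensor, 'a \<Rightarrow> 'a) bracket_module" where
  "Der_P K A = restrict_scalars (mult_map A) (Der K A)"

definition lr_iso ::
    "('k, 'a) module \<Rightarrow> ('a, 'l) lie_rinehart \<Rightarrow> ('a, 'm) lie_rinehart \<Rightarrow> ('l \<Rightarrow> 'm) \<Rightarrow> bool" where
  "lr_iso A L M \<theta> \<longleftrightarrow>
     \<theta> \<in> lie_mod_hom A L M \<and> bij_betw \<theta> (carrier L) (carrier M) \<and>
     (\<forall>x \<in> carrier L. anchor M (\<theta> x) = anchor L x)"

text \<open>Cochains are alternating multilinear maps, i.e. linear maps on exterior powers.\<close>

definition lr_C1 :: "('k, 'a) module \<Rightarrow> ('a, 'l) lie_rinehart \<Rightarrow> ('l \<Rightarrow> 'a) set" where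
  "lr_C1 A L =
     {g \<in> carrier L \<rightarrow> carrier A.
        (\<forall>x \<in> carrier L. \<forall>y \<in> carrier L. g (x \<oplus>\<^bsub>L\<^esub> y) = g x \<oplus>\<^bsub>A\<^esub> g y) \<and>
        (\<forall>a \<in> carrier A. \<forall>x \<in> carrier L. g (a \<odot>\<^bsub>L\<^esub> x) = a \<otimes>\<^bsub>A\<^esub> g x)}"

definition lr_C2 :: "('k, 'a) module \<Rightarrow> ('a, 'l) lie_rinehart \<Rightarrow> ('l \<Rightarrow> 'l \<Rightarrow> 'a) set" where
  "lr_C2 A L =
     {f. (\<forall>x \<in> carrier L. f x \<in> lr_C1 A L \<and> (\<lambda>y. f y x) \<in> lr_C1 A L \<and> f x x = \<zero>\<^bsub>A\<^esub>)}"

definition lr_d1 ::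
    "('k, 'a) module \<Rightarrow> ('a, 'l) lie_rinehart \<Rightarrow> ('l \<Rightarrow> 'a) \<Rightarrow> 'l \<Rightarrow> 'l \<Rightarrow> 'a" where
  "lr_d1 A L g x y = anchor L x (g y) \<ominus>\<^bsub>A\<^esub> anchor L y (g x) \<ominus>\<^bsub>A\<^esub> g (bracket L x y)"

definition lr_d2 ::
    "('k, 'a) module \<Rightarrow> ('a, 'l) lie_rinehart \<Rightarrow> ('l \<Rightarrow> 'l \<Rightarrow> 'a) \<Rightarrow> 'l \<Rightarrow> 'l \<Rightarrow> 'l \<Rightarrow> 'a" where
  "lr_d2 A L f x y z =
     (anchor L x (f y z) \<ominus>\<^bsub>A\<^esub> anchor L y (f x z) \<oplus>\<^bsub>A\<^esub> anchor L z (f x y)) \<ominus>\<^bsub>A\<^esub>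
     f (bracket L x y) z \<oplus>\<^bsub>A\<^esub> f (bracket L x z) y \<ominus>\<^bsub>A\<^esub> f (bracket L y z) x"

definition lr_Z2 :: "('k, 'a) module \<Rightarrow> ('a, 'l) lie_rinehart \<Rightarrow> ('l \<Rightarrow> 'l \<Rightarrow> 'a) set" where
  "lr_Z2 A L =
     {f \<in> lr_C2 A L. \<forall>x \<in> carrier L. \<forall>y \<in> carrier L. \<forall>z \<in> carrier L. lr_d2 A L f x y z = \<zero>\<^bsub>A\<^esub>}"

text \<open>The class of \<open>f\<close> in the second cohomology group, as a coset of the coboundaries.\<close>

definition lr_H2_class ::
    "('k, 'a) module \<Rightarrow> ('a, 'l) lie_rinehart \<Rightarrow> ('l \<Rightarrow> 'l \<Rightarrow> 'a) \<Rightarrow> ('l \<Rightarrow> 'l \<Rightarrow> 'a) set" where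
  "lr_H2_class A L f =
     {f' \<in> lr_Z2 A L. \<exists>g \<in> lr_C1 A L. \<forall>x \<in> carrier L. \<forall>y \<in> carrier L.
        f' x y = f x y \<oplus>\<^bsub>A\<^esub> lr_d1 A L g x y}"

definition pullback :: "('a, 'l) lie_rinehart \<Rightarrow> (('a \<Rightarrow> 'a) \<Rightarrow> ('a \<Rightarrow> 'a) \<Rightarrow> 'a) \<Rightarrow> 'l \<Rightarrow> 'l \<Rightarrow> 'a" where
  "pullback L f x y = f (anchor L x) (anchor L y)"


section \<open>D-Lie algebras\<close>

text \<open>\<open>A \<oplus> L\<close> with the bracket and the left and right multiplications given by a 2-cochain on \<open>L\<close>.
  Its two uses are \<open>D\<^sup>1(A, f)\<close>, where \<open>L\<close> is the module of derivations with identity anchor, and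
  \<open>L(f\<^sup>\<alpha>)\<close>.\<close>

definition lr_extension ::
    "('k, 'a) module \<Rightarrow> ('a, 'l) lie_rinehart \<Rightarrow> ('l \<Rightarrow> 'l \<Rightarrow> 'a) \<Rightarrow> ('a tensor, 'a \<times> 'l) bracket_module"
  where
  "lr_extension A L f =
    \<lparr>carrier = carrier A \<times> carrier L, monoid.mult = undefined, one = undefined,
     ring.zero = (\<zero>\<^bsub>A\<^esub>, \<zero>\<^bsub>L\<^esub>),
     add = (\<lambda>(a, x) (b, y). (a \<oplus>\<^bsub>A\<^esub> b, x \<oplus>\<^bsub>L\<^esub> y)),
     smult = tensor_act (add_monoid A \<times>\<times> add_monoid L)
               (\<lambda>c (a, x). (c \<otimes>\<^bsub>A\<^esub> a, c \<odot>\<^bsub>L\<^esub> x))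
               (\<lambda>(a, x) c. (a \<otimes>\<^bsub>A\<^esub> c \<oplus>\<^bsub>A\<^esub> anchor L x c, c \<odot>\<^bsub>L\<^esub> x)),
     bracket = (\<lambda>(a, x) (b, y). (anchor L x b \<ominus>\<^bsub>A\<^esub> anchor L y a \<oplus>\<^bsub>A\<^esub> f x y, bracket L x y))\<rparr>"

definition D1 ::
    "'k ring \<Rightarrow> ('k, 'a) module \<Rightarrow> (('a \<Rightarrow> 'a) \<Rightarrow> ('a \<Rightarrow> 'a) \<Rightarrow> 'a) \<Rightarrow>
     ('a tensor, 'a \<times> ('a \<Rightarrow> 'a)) bracket_module" where
  "D1 K A f = lr_extension A (Der K A) f"

record ('a, 'l) dlie = "('a tensor, 'l) bracket_module" +
  dalpha :: "'l \<Rightarrow> 'a \<times> ('a \<Rightarrow> 'a)"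
  dpi :: "'l \<Rightarrow> 'a \<Rightarrow> 'a"
  dD :: 'l

text \<open>These axioms do not force \<open>dalpha\<close> to map \<open>D\<close> to the canonical central element \<open>(1, 0)\<close> of
  \<open>D\<^sup>1(A, f)\<close>: the zero module with \<open>D = 0\<close> satisfies them. The \<open>k\<close>-module structure of the Lie
  algebra is the one underlying its module structure over \<open>A \<otimes>\<^sub>k A\<close>.\<close>

definition D_Lie_algebra ::
    "'k ring \<Rightarrow> ('k, 'a) module \<Rightarrow> (('a \<Rightarrow> 'a) \<Rightarrow> ('a \<Rightarrow> 'a) \<Rightarrow> 'a) \<Rightarrow> ('a, 'l) dlie \<Rightarrow> bool" where
  "D_Lie_algebra K A f M \<longleftrightarrow>
     P_module K A M \<and>
     lie_algebra K (restrict_scalars (\<lambda>c. tens K A (c \<odot>\<^bsub>A\<^esub> \<one>\<^bsub>A\<^esub>) \<one>\<^bsub>A\<^esub>) M) \<and>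
     dalpha M \<in> lie_mod_hom (tensor_ring K A) M (D1 K A f) \<and>
     dpi M \<in> lie_mod_hom (tensor_ring K A) M (Der_P K A) \<and>
     (\<forall>u \<in> carrier M. dpi M u = snd (dalpha M u)) \<and>
     (\<forall>u \<in> carrier M. \<forall>v \<in> carrier M. \<forall>a \<in> carrier A.
        bracket M u (tens K A a \<one>\<^bsub>A\<^esub> \<odot>\<^bsub>M\<^esub> v) =
          tens K A a \<one>\<^bsub>A\<^esub> \<odot>\<^bsub>M\<^esub> bracket M u v \<oplus>\<^bsub>M\<^esub> tens K A (dpi M u a) \<one>\<^bsub>A\<^esub> \<odot>\<^bsub>M\<^esub> v) \<and>
     (\<forall>u \<in> carrier M. \<forall>a \<in> carrier A.
        tens_diff K A a \<odot>\<^bsub>M\<^esub> u = tens K A (dpi M u a) \<one>\<^bsub>A\<^esub> \<odot>\<^bsub>M\<^esub> dD M) \<and>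
     dD M \<in> carrier M \<and>
     (\<forall>u \<in> carrier M. bracket M (dD M) u = \<zero>\<^bsub>M\<^esub>) \<and>
     dpi M (dD M) = \<zero>\<^bsub>Der K A\<^esub>"

definition D_Lie_hom ::
    "'k ring \<Rightarrow> ('k, 'a) module \<Rightarrow> ('a, 'l) dlie \<Rightarrow> ('a, 'm) dlie \<Rightarrow> ('l \<Rightarrow> 'm) set" where
  "D_Lie_hom K A M N =
     {\<phi> \<in> lie_mod_hom (tensor_ring K A) M N.
        \<phi> (dD M) = dD N \<and> (\<forall>u \<in> carrier M. dpi M u = dpi N (\<phi> u))}"

definition D_Lie_isomorphic ::
    "'k ring \<Rightarrow> ('k, 'a) module \<Rightarrow> ('a, 'l) dlie \<Rightarrow> ('a, 'm) dlie \<Rightarrow> bool" where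
  "D_Lie_isomorphic K A M N \<longleftrightarrow>
     (\<exists>\<phi> \<in> D_Lie_hom K A M N. bij_betw \<phi> (carrier M) (carrier N))"

definition D_submodule :: "'k ring \<Rightarrow> ('k, 'a) module \<Rightarrow> ('a, 'l) dlie \<Rightarrow> 'l set" where
  "D_submodule K A M = {tens K A a \<one>\<^bsub>A\<^esub> \<odot>\<^bsub>M\<^esub> dD M | a. a \<in> carrier A}"

definition canonical_quotient ::
    "'k ring \<Rightarrow> ('k, 'a) module \<Rightarrow> ('a, 'l) dlie \<Rightarrow> ('a, 'l set) lie_rinehart" where
  "canonical_quotient K A M =
    (let J = D_submodule K A M in
     \<lparr>carrier = a_rcosets\<^bsub>M\<^esub> J, monoid.mult = undefined, one = undefined,
      ring.zero = J, add = set_add M,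
      smult = (\<lambda>a X. \<Union>x\<in>X. J +>\<^bsub>M\<^esub> (tens K A a \<one>\<^bsub>A\<^esub> \<odot>\<^bsub>M\<^esub> x)),
      bracket = (\<lambda>X Y. \<Union>x\<in>X. \<Union>y\<in>Y. J +>\<^bsub>M\<^esub> bracket M x y),
      anchor = (\<lambda>X. the_elem (dpi M ` X))\<rparr>)"

text \<open>The D-Lie algebra \<open>L(f\<^sup>\<alpha>)\<close>.\<close>

definition D_extension ::
    "('k, 'a) module \<Rightarrow> (('a \<Rightarrow> 'a) \<Rightarrow> ('a \<Rightarrow> 'a) \<Rightarrow> 'a) \<Rightarrow> ('a, 'l) lie_rinehart \<Rightarrow> ('a, 'a \<times> 'l) dlie"
  where
  "D_extension A f L =
     bracket_module.extend (lr_extension A L (pullback L f))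
       (dlie.fields (\<lambda>(a, x). (a, anchor L x)) (\<lambda>(a, x). anchor L x) (\<one>\<^bsub>A\<^esub>, \<zero>\<^bsub>L\<^esub>))"

end

theory Submission
  imports Defs
begin

text \<open>Write \<open>\<alpha>(u) = (\<phi> u, \<pi> u)\<close> for the structure map of a D-Lie algebra \<open>M\<close> into \<open>D\<^sup>1(A, f)\<close>. Since
  \<open>\<phi>\<close> is left \<open>A\<close>-linear and \<open>\<phi> D = 1\<close>, it splits off the submodule \<open>J = A D\<close>, so that
  \<open>u \<mapsto> (\<phi> u, u + J)\<close> is a bijection of \<open>M\<close> onto \<open>A \<oplus> L\<close>. It respects the left action and the
  bracket because \<open>\<alpha>\<close> does, and the right action because \<open>u c = c u + \<pi>(u)(c) D\<close>. If
  \<open>f' = f + d g\<close>, replacing \<open>\<phi>\<close> by \<open>\<phi> - g \<circ> \<pi>\<close> gives an isomorphism onto \<open>L(f'\<^sup>\<alpha>)\<close> instead, which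
  yields the uniqueness.\<close>

section \<open>Integer combinations in an abelian group\<close>

text \<open>The delicate point is the scalar action. On \<open>D1\<close> and on
  \<open>D_extension\<close> an element of A \<otimes> A acts through \<open>the_elem\<close> of the
  values of all its coset representatives, so nothing can be computed before these values are known
  to agree. For \<open>D1\<close> this has to be shown from the two commuting actions, because
  linearity of \<open>dalpha\<close> splits into components only once pure tensors can be evaluated
  there. For \<open>D_extension\<close> the comparison map transports the action of
  \<open>M\<close>, where agreement is already known.

  Uniqueness is reached by mapping both algebras onto one model, built from the quotient of
  \<open>M'\<close> and the cocycle \<open>f'\<close>. The isomorphism of quotients and the cochain
  \<open>g\<close> are absorbed into the map out of \<open>M\<close>. The comparison is therefore
  proved for a general target \<open>L'\<close> with an isomorphism \<open>\<theta>\<close> and a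
  general \<open>g\<close>; the first claim is the case of the identity and the zero
  cochain.\<close>

definition frag_prod :: "('g, 'z) monoid_scheme \<Rightarrow> ('p \<Rightarrow> 'g) \<Rightarrow> ('p \<Rightarrow>\<^sub>0 int) \<Rightarrow> 'g" where
  "frag_prod G h x = finprod G (\<lambda>p. h p [^]\<^bsub>G\<^esub> Poly_Mapping.lookup x p) (Poly_Mapping.keys x)"

context comm_group
begin

text \<open>Cancellation can make the support of a difference smaller than the union of the
  supports, so products are compared over a common finite set. Off the support the exponent is
  0.\<close>

lemma frag_prod_superset:
  assumes "finite T" "Poly_Mapping.keys x \<subseteq> T" "h \<in> T \<rightarrow> carrier G"
  shows "frag_prod G h x = finprod G (\<lambda>p. h p [^] Poly_Mapping.lookup x p) T"
  unfolding frag_prod_def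
  using assms by (intro finprod_mono_neutral_cong_left) (auto simp: in_keys_iff)

lemma frag_prod_closed:
  "Poly_Mapping.keys x \<subseteq> S \<Longrightarrow> h \<in> S \<rightarrow> carrier G \<Longrightarrow> frag_prod G h x \<in> carrier G"
  unfolding frag_prod_def by (intro finprod_closed) auto

lemma frag_prod_0 [simp]: "frag_prod G h 0 = \<one>"
  by (simp add: frag_prod_def)

lemma frag_prod_of: "h p \<in> carrier G \<Longrightarrow> frag_prod G h (frag_of p) = h p"
  by (simp add: frag_prod_def)

text \<open>Differences rather than sums, because the induction on the free abelian group has
  subtraction as its only operation.\<close>

lemma frag_prod_diff:
  assumes "Poly_Mapping.keys x \<subseteq> S" "Poly_Mapping.keys y \<subseteq> S" "h \<in> S \<rightarrow> carrier G"
  shows "frag_prod G h (x - y) = frag_prod G h x \<otimes> inv (frag_prod G h y)"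
proof -
  let ?T = "Poly_Mapping.keys x \<union> Poly_Mapping.keys y"
  have fin: "finite ?T" and h: "h \<in> ?T \<rightarrow> carrier G"
    using assms by auto
  have x: "frag_prod G h x = finprod G (\<lambda>p. h p [^] Poly_Mapping.lookup x p) ?T"
    and y: "frag_prod G h y = finprod G (\<lambda>p. h p [^] Poly_Mapping.lookup y p) ?T"
    and xy: "frag_prod G h (x - y) = finprod G (\<lambda>p. h p [^] Poly_Mapping.lookup (x - y) p) ?T"
    by (intro frag_prod_superset fin h keys_diff Un_upper1 Un_upper2)+
  \<comment> \<open>Multiplying the factor for \<open>y\<close> back leaves an identity of exponents
    over one index set, with no inverse inside the product.\<close>
  have "frag_prod G h (x - y) \<otimes> frag_prod G h y =
      finprod G (\<lambda>p. h p [^] Poly_Mapping.lookup (x - y) p \<otimes> h p [^] Poly_Mapping.lookup y p) ?T"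
    unfolding xy y using h by (intro finprod_multf [symmetric]) auto
  also have "\<dots> = frag_prod G h x"
    unfolding x using h
    by (intro finprod_cong') (auto simp: lookup_minus Pi_iff int_pow_mult [symmetric])
  finally show ?thesis
    using assms frag_prod_closed[of "x - y" ?T h] h frag_prod_closed[of x S h] frag_prod_closed[of y S h]
      keys_diff[of x y] by (simp add: inv_solve_right)
qed

end

lemma tensor_act_eq_frag_prod:
  "tensor_act G l r t u = the_elem (frag_prod G (\<lambda>(a, b). l a (r u b)) ` t)"
  by (simp add: tensor_act_def frag_prod_def case_prod_beta')


section \<open>The tensor product as a quotient ring\<close>

lemma pair_ring_simps [simp]:
  "carrier (pair_ring A) = {x. Poly_Mapping.keys x \<subseteq> carrier A \<times> carrier A}"
  "\<zero>\<^bsub>pair_ring A\<^esub> = 0"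
  "x \<oplus>\<^bsub>pair_ring A\<^esub> y = x + y"
  "\<one>\<^bsub>pair_ring A\<^esub> = frag_of (\<one>\<^bsub>A\<^esub>, \<one>\<^bsub>A\<^esub>)"
  by (simp_all add: pair_ring_def)

lemma pair_ring_mult:
  "x \<otimes>\<^bsub>pair_ring A\<^esub> y =
     frag_extend (\<lambda>p. frag_extend (\<lambda>q. frag_of (fst p \<otimes>\<^bsub>A\<^esub> fst q, snd p \<otimes>\<^bsub>A\<^esub> snd q)) y) x"
  by (simp add: pair_ring_def case_prod_beta')

lemma pair_ring_mult_of [simp]:
  "frag_of (a, b) \<otimes>\<^bsub>pair_ring A\<^esub> frag_of (c, d) = frag_of (a \<otimes>\<^bsub>A\<^esub> c, b \<otimes>\<^bsub>A\<^esub> d)"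
  by (simp add: pair_ring_mult)

text \<open>The product of \<open>pair_ring\<close> nests two extensions, so linearity in its right
  factor also needs linearity in the function being extended.\<close>

lemma frag_extend_diff_fun:
  fixes g h :: "'b \<Rightarrow> 'a \<Rightarrow>\<^sub>0 int"
  shows "frag_extend (\<lambda>p. g p - h p) x = frag_extend g x - frag_extend h x"
proof -
  have "frag_cmul c (y - z) = frag_cmul c y - frag_cmul c z" for c and y z :: "'a \<Rightarrow>\<^sub>0 int"
    by (rule poly_mapping_eqI) (simp add: lookup_minus algebra_simps)
  then show ?thesis
    unfolding frag_extend_def sum_subtractf[symmetric] by (intro sum.cong refl)
qed

lemma pair_ring_mult_diff:
  "(x - y) \<otimes>\<^bsub>pair_ring A\<^esub> z = x \<otimes>\<^bsub>pair_ring A\<^esub> z - y \<otimes>\<^bsub>pair_ring A\<^esub> z"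
  "z \<otimes>\<^bsub>pair_ring A\<^esub> (x - y) = z \<otimes>\<^bsub>pair_ring A\<^esub> x - z \<otimes>\<^bsub>pair_ring A\<^esub> y"
  by (simp_all add: pair_ring_mult frag_extend_diff frag_extend_diff_fun)

locale tensor_algebra = A: cring A + KA: algebra K A for K :: "'k ring" and A :: "('k, 'a) module"
begin

abbreviation frags :: "('a \<times> 'a \<Rightarrow>\<^sub>0 int) set" where
  "frags \<equiv> {x. Poly_Mapping.keys x \<subseteq> carrier A \<times> carrier A}"

text \<open>Reduces identities that are additive in an argument to pure pairs, where they become
  identities in \<open>A\<close> or between the two actions.\<close>

lemma frag_pair_induct [consumes 1, case_names zero pair diff]:
  assumes "x \<in> frags" "P 0"
    and "\<And>a b. a \<in> carrier A \<Longrightarrow> b \<in> carrier A \<Longrightarrow> P (frag_of (a, b))"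
    and "\<And>x y. x \<in> frags \<Longrightarrow> y \<in> frags \<Longrightarrow> P x \<Longrightarrow> P y \<Longrightarrow> P (x - y)"
  shows "P x"
proof (rule free_Abelian_group_induct)
  show "Poly_Mapping.keys x \<subseteq> carrier A \<times> carrier A"
    using assms(1) by simp
qed (use assms(2-4) in auto)

section \<open>Ring laws of the integral monoid ring on pairs\<close>

lemma pair_ring_closed:
  assumes x: "x \<in> frags" and y: "y \<in> frags"
  shows "x \<otimes>\<^bsub>pair_ring A\<^esub> y \<in> frags"
proof -
  have "Poly_Mapping.keys (frag_extend (\<lambda>q. frag_of (fst p \<otimes>\<^bsub>A\<^esub> fst q, snd p \<otimes>\<^bsub>A\<^esub> snd q)) y)
      \<subseteq> carrier A \<times> carrier A" if "p \<in> Poly_Mapping.keys x" for p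
    by (rule order_trans[OF keys_frag_extend]) (use x y that in \<open>auto simp: keys_frag_of intro!: A.m_closed\<close>)
  then have "(\<Union>p\<in>Poly_Mapping.keys x. Poly_Mapping.keys
      (frag_extend (\<lambda>q. frag_of (fst p \<otimes>\<^bsub>A\<^esub> fst q, snd p \<otimes>\<^bsub>A\<^esub> snd q)) y)) \<subseteq> carrier A \<times> carrier A"
    by (rule UN_least)
  with keys_frag_extend show ?thesis
    unfolding pair_ring_mult mem_Collect_eq by (rule order_trans)
qed

lemma pair_ring_mult_zero [simp]:
  "0 \<otimes>\<^bsub>pair_ring A\<^esub> x = 0" "x \<otimes>\<^bsub>pair_ring A\<^esub> 0 = 0"
  by (simp_all add: pair_ring_mult frag_extend_eq_0)

lemma pair_ring_comm:
  assumes x: "x \<in> frags" and y: "y \<in> frags"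
  shows "x \<otimes>\<^bsub>pair_ring A\<^esub> y = y \<otimes>\<^bsub>pair_ring A\<^esub> x"
  using x
proof (induction x rule: frag_pair_induct)
  case (pair a b)
  show ?case
    using y by (induction y rule: frag_pair_induct) (simp_all add: pair pair_ring_mult_diff A.m_comm)
qed (simp_all add: pair_ring_mult_diff)

lemma pair_ring_assoc:
  assumes x: "x \<in> frags" and y: "y \<in> frags" and z: "z \<in> frags"
  shows "x \<otimes>\<^bsub>pair_ring A\<^esub> y \<otimes>\<^bsub>pair_ring A\<^esub> z = x \<otimes>\<^bsub>pair_ring A\<^esub> (y \<otimes>\<^bsub>pair_ring A\<^esub> z)"
  using x
proof (induction x rule: frag_pair_induct)
  case (pair a b)
  show ?case
    using y
  proof (induction y rule: frag_pair_induct)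
    case (pair c d)
    show ?case
      using z \<open>a \<in> carrier A\<close> \<open>b \<in> carrier A\<close>
      by (induction z rule: frag_pair_induct) (simp_all add: pair pair_ring_mult_diff A.m_assoc)
  qed (simp_all add: pair_ring_mult_diff)
qed (simp_all add: pair_ring_mult_diff)

lemma pair_ring_one:
  assumes x: "x \<in> frags"
  shows "\<one>\<^bsub>pair_ring A\<^esub> \<otimes>\<^bsub>pair_ring A\<^esub> x = x"
  using x by (induction x rule: frag_pair_induct) (simp_all add: pair_ring_mult_diff)

lemma pair_ring_distrib:
  "(x + y) \<otimes>\<^bsub>pair_ring A\<^esub> z = x \<otimes>\<^bsub>pair_ring A\<^esub> z + y \<otimes>\<^bsub>pair_ring A\<^esub> z"
  by (simp add: pair_ring_mult frag_extend_add)

lemma cring_pair_ring: "cring (pair_ring A)"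
proof (rule cringI)
  show "abelian_group (pair_ring A)"
  proof (rule abelian_groupI)
    fix x assume "x \<in> carrier (pair_ring A)"
    then show "\<exists>y\<in>carrier (pair_ring A). y \<oplus>\<^bsub>pair_ring A\<^esub> x = \<zero>\<^bsub>pair_ring A\<^esub>"
      by (intro bexI [of _ "- x"]) auto
  qed (auto simp: add_ac dest: subsetD[OF keys_add])
  show "comm_monoid (pair_ring A)"
  proof (rule comm_monoidI)
    show "\<one>\<^bsub>pair_ring A\<^esub> \<in> carrier (pair_ring A)"
      by (simp add: keys_frag_of)
  qed (unfold pair_ring_simps(1); rule pair_ring_closed pair_ring_assoc pair_ring_one pair_ring_comm; assumption)+
qed (simp add: pair_ring_distrib)

sublocale PR: cring "pair_ring A"
  by (rule cring_pair_ring)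

lemma pair_ring_a_inv [simp]: "x \<in> frags \<Longrightarrow> \<ominus>\<^bsub>pair_ring A\<^esub> x = - x"
  by (intro PR.minus_equality) auto

lemma pair_ring_minus [simp]: "y \<in> frags \<Longrightarrow> x \<ominus>\<^bsub>pair_ring A\<^esub> y = x - y"
  by (simp add: a_minus_def)

lemma tensor_relations_subset: "tensor_relations K A \<subseteq> carrier (pair_ring A)"
proof -
  have "frag_of p - frag_of q - frag_of s \<in> frags" "frag_of p - frag_of q \<in> frags"
    if "p \<in> carrier A \<times> carrier A" "q \<in> carrier A \<times> carrier A" "s \<in> carrier A \<times> carrier A" for p q s
    using that keys_diff[of "frag_of p - frag_of q" "frag_of s"] keys_diff[of "frag_of p" "frag_of q"]
    by (auto simp: keys_frag_of)
  note diff = this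
  show ?thesis
    unfolding tensor_relations_def
    by (intro Un_least subsetI; elim CollectE exE conjE; hypsubst; unfold pair_ring_simps(1); intro diff)
      auto
qed

section \<open>The quotient ring and its pure tensors\<close>

sublocale TI: ideal "tensor_ideal K A" "pair_ring A"
  unfolding tensor_ideal_def by (rule PR.genideal_ideal[OF tensor_relations_subset])

abbreviation coset where "coset x \<equiv> tensor_ideal K A +>\<^bsub>pair_ring A\<^esub> x"

sublocale TR: cring "tensor_ring K A"
  unfolding tensor_ring_def by (rule TI.quotient_is_cring[OF PR.is_cring])

sublocale coset: ring_hom_cring "pair_ring A" "tensor_ring K A" coset
  unfolding tensor_ring_def by (rule TI.rcos_ring_hom_cring[OF PR.is_cring])

lemma coset_diff: "x \<in> frags \<Longrightarrow> y \<in> frags \<Longrightarrow> coset (x - y) = coset x \<ominus>\<^bsub>tensor_ring K A\<^esub> coset y"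
  using coset.hom_add[of x "- y"] coset.hom_a_inv[of y]
  by (simp add: a_minus_def)

lemma tensor_ring_cases:
  assumes "t \<in> carrier (tensor_ring K A)"
  obtains x where "x \<in> frags" "t = coset x"
proof -
  have "t \<in> a_rcosets\<^bsub>pair_ring A\<^esub> tensor_ideal K A"
    using assms by (simp add: tensor_ring_def FactRing_def)
  then show ?thesis
    using that unfolding A_RCOSETS_def' a_r_coset_def' pair_ring_simps(1) by blast
qed

lemma coset_repr:
  assumes "x \<in> frags" "y \<in> coset x"
  shows "y \<in> frags" "coset y = coset x"
proof -
  show "y \<in> frags"
    using TI.a_elemrcos_carrier[of x y] assms by simp
  show "coset y = coset x"
    using TI.a_repr_independence'[of y x] assms by simp
qed

lemma coset_self: "x \<in> frags \<Longrightarrow> x \<in> coset x"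
  using TI.a_rcos_self by auto


lemma frag_of_closed: "a \<in> carrier A \<Longrightarrow> b \<in> carrier A \<Longrightarrow> frag_of (a, b) \<in> frags"
  by (simp add: keys_frag_of)

lemma tens_closed [simp, intro]:
  "a \<in> carrier A \<Longrightarrow> b \<in> carrier A \<Longrightarrow> tens K A a b \<in> carrier (tensor_ring K A)"
  unfolding tens_def by (rule coset.hom_closed) (simp add: keys_frag_of)

lemma tens_mult:
  assumes "a \<in> carrier A" "b \<in> carrier A" "c \<in> carrier A" "d \<in> carrier A"
  shows "tens K A a b \<otimes>\<^bsub>tensor_ring K A\<^esub> tens K A c d = tens K A (a \<otimes>\<^bsub>A\<^esub> c) (b \<otimes>\<^bsub>A\<^esub> d)"
  unfolding tens_def using assms
  by (subst coset.hom_mult [symmetric]) (simp_all add: keys_frag_of)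

lemma tens_one: "tens K A \<one>\<^bsub>A\<^esub> \<one>\<^bsub>A\<^esub> = \<one>\<^bsub>tensor_ring K A\<^esub>"
  unfolding tens_def using coset.hom_one by simp

lemma tens_add:
  assumes "a \<in> carrier A" "a' \<in> carrier A" "b \<in> carrier A"
  shows "tens K A (a \<oplus>\<^bsub>A\<^esub> a') b = tens K A a b \<oplus>\<^bsub>tensor_ring K A\<^esub> tens K A a' b"
proof -
  let ?p = "frag_of (a \<oplus>\<^bsub>A\<^esub> a', b)" and ?q = "frag_of (a, b)" and ?s = "frag_of (a', b)"
  have frags: "?p \<in> frags" "?q \<in> frags" "?s \<in> frags"
    using assms by (simp_all add: keys_frag_of)
  \<comment> \<open>The relation is regrouped as a single difference, the form in which membership
    in a coset is tested.\<close>
  have "?p - (?q + ?s) \<in> tensor_relations K A"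
    using assms unfolding tensor_relations_def diff_diff_eq [symmetric] by blast
  then have rel: "?p - (?q + ?s) \<in> tensor_ideal K A"
    using PR.genideal_self [OF tensor_relations_subset] by (auto simp: tensor_ideal_def)
  have qs: "?q + ?s \<in> frags"
    using PR.a_closed [of ?q ?s] frags by simp
  then have "?p \<in> coset (?q + ?s)"
    using TI.a_rcos_module_minus [OF PR.ring_axioms, of "?q + ?s" ?p] rel frags by simp
  with qs have "coset ?p = coset (?q + ?s)"
    by (rule coset_repr)
  also have "\<dots> = coset ?q \<oplus>\<^bsub>tensor_ring K A\<^esub> coset ?s"
    using coset.hom_add [of ?q ?s] frags by simp
  finally show ?thesis
    unfolding tens_def .
qed

text \<open>The action on \<open>G\<close> need not be assumed well defined: all representatives of \<open>t\<close>
  compute the same element \<open>\<psi> (t u)\<close>.\<close>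

lemma hom_tensor_act:
  assumes M: "module (tensor_ring K A) M" and G: "comm_group G"
    and \<psi>: "\<psi> \<in> hom (add_monoid M) G"
    and tens: "\<And>a b. a \<in> carrier A \<Longrightarrow> b \<in> carrier A \<Longrightarrow>
      \<psi> (tens K A a b \<odot>\<^bsub>M\<^esub> u) = l a (r (\<psi> u) b)"
    and t: "t \<in> carrier (tensor_ring K A)" and u: "u \<in> carrier M"
  shows "\<psi> (t \<odot>\<^bsub>M\<^esub> u) = tensor_act G l r t (\<psi> u)"
proof -
  interpret M: module "tensor_ring K A" M by (rule M)
  interpret G: comm_group G by (rule G)
  interpret \<psi>: group_hom "add_monoid M" G \<psi>
    using \<psi> by (simp add: group_hom_def group_hom_axioms_def M.a_group G.is_group)
  have \<psi>_add: "\<psi> (v \<oplus>\<^bsub>M\<^esub> w) = \<psi> v \<otimes>\<^bsub>G\<^esub> \<psi> w" and \<psi>_inv: "\<psi> (\<ominus>\<^bsub>M\<^esub> v) = inv\<^bsub>G\<^esub> \<psi> v"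
    if "v \<in> carrier M" "w \<in> carrier M" for v w
    using \<psi>.hom_mult [of v w] \<psi>.hom_inv [of v] that unfolding a_inv_def by simp_all
  let ?h = "\<lambda>(a, b). l a (r (\<psi> u) b)"
  \<comment> \<open>Closure of \<open>l\<close> and \<open>r\<close> is not among the hypotheses:
    the values lie in \<open>G\<close> because \<open>tens\<close> exhibits them as images under
    \<open>\<psi>\<close>.\<close>
  have h: "?h \<in> carrier A \<times> carrier A \<rightarrow> carrier G"
    using u \<psi>.hom_closed by (auto simp flip: tens)
  \<comment> \<open>Both sides are homomorphisms in \<open>x\<close> from the free abelian group to
    \<open>G\<close>, and \<open>tens\<close> says that they agree on generators.\<close>
  have *: "frag_prod G ?h x = \<psi> (coset x \<odot>\<^bsub>M\<^esub> u)" if "x \<in> frags" for x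
    using that
  proof (induction x rule: frag_pair_induct)
    case zero
    have "coset 0 = \<zero>\<^bsub>tensor_ring K A\<^esub>"
      using coset.hom_zero by simp
    then show ?case
      using u \<psi>.hom_one by simp
  next
    case (pair a b)
    then have "?h (a, b) \<in> carrier G"
      using h by blast
    with pair tens [of a b] show ?case
      by (simp add: G.frag_prod_of flip: tens_def)
  next
    case (diff x y)
    have closed: "coset x \<in> carrier (tensor_ring K A)" "coset y \<in> carrier (tensor_ring K A)"
      using diff coset.hom_closed by auto
    then have "\<psi> (coset (x - y) \<odot>\<^bsub>M\<^esub> u) = \<psi> (coset x \<odot>\<^bsub>M\<^esub> u \<oplus>\<^bsub>M\<^esub> \<ominus>\<^bsub>M\<^esub> (coset y \<odot>\<^bsub>M\<^esub> u))"
      using diff u by (simp add: coset_diff a_minus_def M.smult_l_distr M.smult_l_minus)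
    also have "\<dots> = \<psi> (coset x \<odot>\<^bsub>M\<^esub> u) \<otimes>\<^bsub>G\<^esub> inv\<^bsub>G\<^esub> \<psi> (coset y \<odot>\<^bsub>M\<^esub> u)"
      using closed u by (simp only: \<psi>_add \<psi>_inv M.smult_closed M.a_inv_closed)
    also have "\<dots> = frag_prod G ?h (x - y)"
      using diff
      by (subst G.frag_prod_diff [OF _ _ h]) simp_all
    finally show ?case ..
  qed
  obtain x where x: "x \<in> frags" "t = coset x"
    using t by (rule tensor_ring_cases)
  have val: "frag_prod G ?h y = \<psi> (t \<odot>\<^bsub>M\<^esub> u)" if "y \<in> t" for y
    using * [of y] coset_repr [OF x(1), of y] that unfolding x(2) by simp
  have "x \<in> t"
    using coset_self x by simp
  then have "frag_prod G ?h ` t = {\<psi> (t \<odot>\<^bsub>M\<^esub> u)}"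
    by (subst image_cong [OF refl val]) auto
  then show ?thesis
    by (simp add: tensor_act_eq_frag_prod)
qed

end

text \<open>The bimodule laws from which well-definedness is proved when there is no module to
  transport the action from, as for \<open>D1\<close>. The law \<open>balanced\<close> matches the
  relations over k.\<close>

locale tensor_action = tensor_algebra K A + G: comm_group G
  for K :: "'k ring" and A :: "('k, 'a) module" and G :: "('m, 'z) monoid_scheme" +
  fixes l :: "'a \<Rightarrow> 'm \<Rightarrow> 'm" and r :: "'m \<Rightarrow> 'a \<Rightarrow> 'm"
  assumes l_closed: "\<And>a u. a \<in> carrier A \<Longrightarrow> u \<in> carrier G \<Longrightarrow> l a u \<in> carrier G"
    and r_closed: "\<And>a u. a \<in> carrier A \<Longrightarrow> u \<in> carrier G \<Longrightarrow> r u a \<in> carrier G"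
    and l_distr: "\<And>a u v. a \<in> carrier A \<Longrightarrow> u \<in> carrier G \<Longrightarrow> v \<in> carrier G \<Longrightarrow>
      l a (u \<otimes>\<^bsub>G\<^esub> v) = l a u \<otimes>\<^bsub>G\<^esub> l a v"
    and r_distr: "\<And>a u v. a \<in> carrier A \<Longrightarrow> u \<in> carrier G \<Longrightarrow> v \<in> carrier G \<Longrightarrow>
      r (u \<otimes>\<^bsub>G\<^esub> v) a = r u a \<otimes>\<^bsub>G\<^esub> r v a"
    and l_add: "\<And>a b u. a \<in> carrier A \<Longrightarrow> b \<in> carrier A \<Longrightarrow> u \<in> carrier G \<Longrightarrow>
      l (a \<oplus>\<^bsub>A\<^esub> b) u = l a u \<otimes>\<^bsub>G\<^esub> l b u"
    and r_add: "\<And>a b u. a \<in> carrier A \<Longrightarrow> b \<in> carrier A \<Longrightarrow> u \<in> carrier G \<Longrightarrow>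
      r u (a \<oplus>\<^bsub>A\<^esub> b) = r u a \<otimes>\<^bsub>G\<^esub> r u b"
    and l_mult: "\<And>a b u. a \<in> carrier A \<Longrightarrow> b \<in> carrier A \<Longrightarrow> u \<in> carrier G \<Longrightarrow>
      l (a \<otimes>\<^bsub>A\<^esub> b) u = l a (l b u)"
    and r_mult: "\<And>a b u. a \<in> carrier A \<Longrightarrow> b \<in> carrier A \<Longrightarrow> u \<in> carrier G \<Longrightarrow>
      r u (a \<otimes>\<^bsub>A\<^esub> b) = r (r u b) a"
    and l_r: "\<And>a b u. a \<in> carrier A \<Longrightarrow> b \<in> carrier A \<Longrightarrow> u \<in> carrier G \<Longrightarrow>
      r (l a u) b = l a (r u b)"
    and balanced: "\<And>c a b u. c \<in> carrier K \<Longrightarrow> a \<in> carrier A \<Longrightarrow> b \<in> carrier A \<Longrightarrow> u \<in> carrier G \<Longrightarrow>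
      l (c \<odot>\<^bsub>A\<^esub> a) (r u b) = l a (r u (c \<odot>\<^bsub>A\<^esub> b))"
begin

abbreviation act where "act x u \<equiv> frag_prod G (\<lambda>(a, b). l a (r u b)) x"

lemma pair_act_Pi:
  "u \<in> carrier G \<Longrightarrow> (\<lambda>(a, b). l a (r u b)) \<in> carrier A \<times> carrier A \<rightarrow> carrier G"
  using l_closed r_closed by auto

lemma act_closed: "x \<in> frags \<Longrightarrow> u \<in> carrier G \<Longrightarrow> act x u \<in> carrier G"
  by (rule G.frag_prod_closed [OF _ pair_act_Pi]) auto

lemma act_of:
  "a \<in> carrier A \<Longrightarrow> b \<in> carrier A \<Longrightarrow> u \<in> carrier G \<Longrightarrow> act (frag_of (a, b)) u = l a (r u b)"
  using l_closed r_closed by (simp add: G.frag_prod_of)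

lemma act_diff:
  "x \<in> frags \<Longrightarrow> y \<in> frags \<Longrightarrow> u \<in> carrier G \<Longrightarrow>
    act (x - y) u = act x u \<otimes>\<^bsub>G\<^esub> inv\<^bsub>G\<^esub> (act y u)"
  by (rule G.frag_prod_diff [OF _ _ pair_act_Pi]) auto

lemma pair_hom:
  assumes "a \<in> carrier A" "b \<in> carrier A"
  shows "group_hom G G (\<lambda>u. l a (r u b))"
  using assms l_closed r_closed l_distr r_distr
  by (auto simp: group_hom_def group_hom_axioms_def hom_def)

text \<open>Makes the trivially acting elements absorb products. On pure pairs it is
  multiplicativity of both actions together with their commutation.\<close>

lemma act_mult:
  assumes x: "x \<in> frags" and y: "y \<in> frags" and u: "u \<in> carrier G"
  shows "act (x \<otimes>\<^bsub>pair_ring A\<^esub> y) u = act x (act y u)"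
  using x
proof (induction x rule: frag_pair_induct)
  case zero
  then show ?case by simp
next
  case (pair a b)
  interpret ab: group_hom G G "\<lambda>u. l a (r u b)"
    using pair by (rule pair_hom)
  have "act (frag_of (a, b) \<otimes>\<^bsub>pair_ring A\<^esub> y) u = l a (r (act y u) b)"
    using y
  proof (induction y rule: frag_pair_induct)
    case zero
    then show ?case using ab.hom_one by simp
  next
    case (pair c d)
    then show ?case
      using \<open>a \<in> carrier A\<close> \<open>b \<in> carrier A\<close> u
      by (simp add: act_of l_mult r_mult l_r l_closed r_closed A.m_closed)
  next
    case (diff x y)
    then show ?case
      using u pair pair_ring_closed [OF frag_of_closed]
      by (simp only: pair_ring_mult_diff act_diff act_closed G.inv_closed ab.hom_mult ab.hom_inv)
  qed
  then show ?case
    using pair act_closed [OF y u] by (simp add: act_of)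
next
  case (diff x z)
  then show ?case
    using y u pair_ring_closed
    by (simp only: pair_ring_mult_diff act_diff act_closed)
qed

lemma act_relation:
  assumes x: "x \<in> tensor_relations K A" and u: "u \<in> carrier G"
  shows "act x u = \<one>\<^bsub>G\<^esub>"
proof -
  \<comment> \<open>Both families of additivity relations have this shape: the first pair acts as
    the sum of the other two.\<close>
  have split: "act (frag_of (a, b) - frag_of (c, d) - frag_of (c', d')) u = \<one>\<^bsub>G\<^esub>"
    if ab: "a \<in> carrier A" "b \<in> carrier A" and cd: "c \<in> carrier A" "d \<in> carrier A"
      and cd': "c' \<in> carrier A" "d' \<in> carrier A"
      and eq: "l a (r u b) = l c (r u d) \<otimes>\<^bsub>G\<^esub> l c' (r u d')" for a b c d c' d'
  proof -
    have "frag_of (a, b) - frag_of (c, d) \<in> frags"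
      using PR.minus_closed [of "frag_of (a, b)" "frag_of (c, d)"] ab cd by (simp add: keys_frag_of)
    then have "act (frag_of (a, b) - frag_of (c, d) - frag_of (c', d')) u =
        l a (r u b) \<otimes>\<^bsub>G\<^esub> inv\<^bsub>G\<^esub> l c (r u d) \<otimes>\<^bsub>G\<^esub> inv\<^bsub>G\<^esub> l c' (r u d')"
      using ab cd cd' u by (simp only: act_diff frag_of_closed act_of)
    also have "l a (r u b) = l c' (r u d') \<otimes>\<^bsub>G\<^esub> l c (r u d)"
      using cd cd' u by (simp add: eq G.m_comm l_closed r_closed)
    finally show ?thesis
      using cd cd' u by (simp add: G.m_assoc l_closed r_closed)
  qed
  show ?thesis
    using x unfolding tensor_relations_def
  proof (elim UnE CollectE exE conjE)
    fix a a' b assume "x = frag_of (a \<oplus>\<^bsub>A\<^esub> a', b) - frag_of (a, b) - frag_of (a', b)"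
      "a \<in> carrier A" "a' \<in> carrier A" "b \<in> carrier A"
    with u show ?thesis
      by (simp only: split A.a_closed l_add r_closed)
  next
    fix a b b' assume "x = frag_of (a, b \<oplus>\<^bsub>A\<^esub> b') - frag_of (a, b) - frag_of (a, b')"
      "a \<in> carrier A" "b \<in> carrier A" "b' \<in> carrier A"
    with u show ?thesis
      by (simp only: split A.a_closed r_add l_distr r_closed)
  next
    fix c a b assume *: "x = frag_of (c \<odot>\<^bsub>A\<^esub> a, b) - frag_of (a, c \<odot>\<^bsub>A\<^esub> b)"
      "c \<in> carrier K" "a \<in> carrier A" "b \<in> carrier A"
    then show ?thesis
      using u l_closed r_closed KA.smult_closed
      by (simp only: act_diff frag_of_closed act_of balanced G.r_inv)
  qed
qed

lemma act_ideal:
  assumes x: "x \<in> tensor_ideal K A" and u: "u \<in> carrier G"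
  shows "act x u = \<one>\<^bsub>G\<^esub>"
proof -
  \<comment> \<open>The elements acting trivially form an ideal, which contains the defining relations.\<close>
  let ?I = "{x \<in> frags. \<forall>u\<in>carrier G. act x u = \<one>\<^bsub>G\<^esub>}"
  \<comment> \<open>For absorption: \<open>y \<otimes> x\<close> acts by first applying
    \<open>x\<close>, which gives the neutral element, and then \<open>y\<close>, which must fix
    it.\<close>
  have act_one: "act x \<one>\<^bsub>G\<^esub> = \<one>\<^bsub>G\<^esub>" if "x \<in> frags" for x
    using that
  proof (induction x rule: frag_pair_induct)
    case (pair a b)
    then show ?case
      using group_hom.hom_one [OF pair_hom] by (simp add: act_of)
  qed (simp_all add: act_diff)
  have "ideal ?I (pair_ring A)"
  proof (rule idealI)
    show "subgroup ?I (add_monoid (pair_ring A))"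
    proof (rule group.subgroupI [OF PR.a_group])
      fix x y assume x: "x \<in> ?I" and y: "y \<in> ?I"
      have "\<ominus>\<^bsub>pair_ring A\<^esub> x \<in> ?I"
        using x act_diff [of 0 x] by auto
      then show "inv\<^bsub>add_monoid (pair_ring A)\<^esub> x \<in> ?I"
        by (simp only: a_inv_def)
      \<comment> \<open>The sum is written with subtractions so that \<open>act_diff\<close>
        applies.\<close>
      have "x - (0 - y) \<in> ?I"
        using x y PR.minus_closed [of x "- y"] act_diff [of x "0 - y"] act_diff [of 0 y] by auto
      then show "x \<otimes>\<^bsub>add_monoid (pair_ring A)\<^esub> y \<in> ?I"
        by simp
    qed auto
  next
    fix x y assume x: "x \<in> ?I" and y: "y \<in> carrier (pair_ring A)"
    then show "y \<otimes>\<^bsub>pair_ring A\<^esub> x \<in> ?I"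
      using pair_ring_closed [of y x] by (auto simp: act_mult act_one)
    then show "x \<otimes>\<^bsub>pair_ring A\<^esub> y \<in> ?I"
      using x y pair_ring_comm [of x y] by simp
  qed (rule PR.ring_axioms)
  moreover have "tensor_relations K A \<subseteq> ?I"
    using tensor_relations_subset act_relation by auto
  ultimately show ?thesis
    using PR.genideal_minimal [of ?I "tensor_relations K A"] x u unfolding tensor_ideal_def by blast
qed

text \<open>Representatives of a coset differ by an element of the ideal, which acts trivially, so
  \<open>the_elem\<close> is taken of a singleton.\<close>

lemma tensor_act_tens:
  assumes a: "a \<in> carrier A" and b: "b \<in> carrier A" and u: "u \<in> carrier G"
  shows "tensor_act G l r (tens K A a b) u = l a (r u b)"
proof -
  note ab = frag_of_closed [OF a b]
  have val: "act x u = l a (r u b)" if x: "x \<in> tens K A a b" for x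
  proof -
    have xf: "x \<in> frags"
      using coset_repr [OF ab, of x] x unfolding tens_def by auto
    then have "x \<ominus>\<^bsub>pair_ring A\<^esub> frag_of (a, b) \<in> tensor_ideal K A"
      using TI.a_rcos_module_minus [OF PR.ring_axioms, of "frag_of (a, b)" x] ab x by (simp add: tens_def)
    then have "act (x - frag_of (a, b)) u = \<one>\<^bsub>G\<^esub>"
      using act_ideal u ab by simp
    then have "act x u = act (frag_of (a, b)) u"
      using xf ab u by (simp add: act_diff act_closed G.inv_solve_right')
    then show ?thesis
      using a b u by (simp add: act_of)
  qed
  have "frag_of (a, b) \<in> tens K A a b"
    using coset_self [OF ab] by (simp add: tens_def)
  then have "(\<lambda>x. act x u) ` tens K A a b = {l a (r u b)}"
    by (subst image_cong [OF refl val]) auto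
  then show ?thesis
    by (simp add: tensor_act_eq_frag_prod)
qed

end


section \<open>Derivations and the action on \<open>D\<^sup>1(A, f)\<close>\<close>

lemma comm_group_DirProd:
  assumes "comm_group G" "comm_group H"
  shows "comm_group (G \<times>\<times> H)"
proof -
  interpret G: comm_group G by (rule assms)
  interpret H: comm_group H by (rule assms)
  show ?thesis
    by (rule group.group_comm_groupI [OF DirProd_group [OF G.is_group H.is_group]])
      (auto simp: G.m_comm H.m_comm)
qed

section \<open>Derivations as an abelian group with left multiplication\<close>

lemma Der_simps [simp]:
  "carrier (Der K A) = derivations K A"
  "\<zero>\<^bsub>Der K A\<^esub> = (\<lambda>a \<in> carrier A. \<zero>\<^bsub>A\<^esub>)"
  "x \<oplus>\<^bsub>Der K A\<^esub> y = (\<lambda>a \<in> carrier A. x a \<oplus>\<^bsub>A\<^esub> y a)"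
  "c \<odot>\<^bsub>Der K A\<^esub> x = (\<lambda>a \<in> carrier A. c \<otimes>\<^bsub>A\<^esub> x a)"
  "anchor (Der K A) x = x"
  by (simp_all add: Der_def)

context tensor_algebra
begin

lemma derivationD:
  assumes "x \<in> derivations K A"
  shows derivation_closed: "a \<in> carrier A \<Longrightarrow> x a \<in> carrier A"
    and derivation_add: "a \<in> carrier A \<Longrightarrow> b \<in> carrier A \<Longrightarrow> x (a \<oplus>\<^bsub>A\<^esub> b) = x a \<oplus>\<^bsub>A\<^esub> x b"
    and derivation_smult: "c \<in> carrier K \<Longrightarrow> a \<in> carrier A \<Longrightarrow> x (c \<odot>\<^bsub>A\<^esub> a) = c \<odot>\<^bsub>A\<^esub> x a"
    and derivation_mult: "a \<in> carrier A \<Longrightarrow> b \<in> carrier A \<Longrightarrow>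
      x (a \<otimes>\<^bsub>A\<^esub> b) = a \<otimes>\<^bsub>A\<^esub> x b \<oplus>\<^bsub>A\<^esub> x a \<otimes>\<^bsub>A\<^esub> b"
    and derivation_extensional: "x \<in> extensional (carrier A)"
  using assms by (auto simp: derivations_def PiE_def)

lemma derivation_one:
  assumes x: "x \<in> derivations K A"
  shows "x \<one>\<^bsub>A\<^esub> = \<zero>\<^bsub>A\<^esub>"
proof -
  have "x \<one>\<^bsub>A\<^esub> \<in> carrier A"
    using x by (simp add: derivation_closed)
  moreover have "x \<one>\<^bsub>A\<^esub> = x \<one>\<^bsub>A\<^esub> \<oplus>\<^bsub>A\<^esub> x \<one>\<^bsub>A\<^esub>"
    using derivation_mult [OF x, of "\<one>\<^bsub>A\<^esub>" "\<one>\<^bsub>A\<^esub>"] derivation_closed [OF x] by simp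
  ultimately show ?thesis
    by (metis A.add.l_cancel_one)
qed

lemma derivation_diff:
  assumes x: "x \<in> derivations K A" and a: "a \<in> carrier A" and b: "b \<in> carrier A"
  shows "x (a \<ominus>\<^bsub>A\<^esub> b) = x a \<ominus>\<^bsub>A\<^esub> x b"
proof -
  have ab: "a \<ominus>\<^bsub>A\<^esub> b \<in> carrier A"
    using a b by simp
  have "(a \<ominus>\<^bsub>A\<^esub> b) \<oplus>\<^bsub>A\<^esub> b = a"
    using a b by algebra
  then have eq: "x (a \<ominus>\<^bsub>A\<^esub> b) \<oplus>\<^bsub>A\<^esub> x b = x a"
    using derivation_add [OF x ab b] by simp
  have "x (a \<ominus>\<^bsub>A\<^esub> b) \<in> carrier A" "x b \<in> carrier A"
    using derivation_closed [OF x] b ab by auto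
  then show ?thesis
    unfolding eq [symmetric] by algebra
qed

lemma derivationI:
  assumes "\<And>a. a \<in> carrier A \<Longrightarrow> h a \<in> carrier A"
    and "\<And>a b. a \<in> carrier A \<Longrightarrow> b \<in> carrier A \<Longrightarrow> h (a \<oplus>\<^bsub>A\<^esub> b) = h a \<oplus>\<^bsub>A\<^esub> h b"
    and "\<And>c a. c \<in> carrier K \<Longrightarrow> a \<in> carrier A \<Longrightarrow> h (c \<odot>\<^bsub>A\<^esub> a) = c \<odot>\<^bsub>A\<^esub> h a"
    and "\<And>a b. a \<in> carrier A \<Longrightarrow> b \<in> carrier A \<Longrightarrow> h (a \<otimes>\<^bsub>A\<^esub> b) = a \<otimes>\<^bsub>A\<^esub> h b \<oplus>\<^bsub>A\<^esub> h a \<otimes>\<^bsub>A\<^esub> b"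
  shows "(\<lambda>a \<in> carrier A. h a) \<in> derivations K A"
  using assms by (simp add: derivations_def A.a_closed A.m_closed KA.smult_closed)

lemma smult_mult_right:
  "c \<in> carrier K \<Longrightarrow> a \<in> carrier A \<Longrightarrow> b \<in> carrier A \<Longrightarrow> a \<otimes>\<^bsub>A\<^esub> (c \<odot>\<^bsub>A\<^esub> b) = c \<odot>\<^bsub>A\<^esub> (a \<otimes>\<^bsub>A\<^esub> b)"
  using KA.smult_assoc2 [of c b a] by (simp add: A.m_comm)

lemma derivations_zero: "\<zero>\<^bsub>Der K A\<^esub> \<in> derivations K A"
  unfolding Der_simps by (rule derivationI) simp_all

lemma derivations_add:
  assumes "x \<in> derivations K A" "y \<in> derivations K A"
  shows "x \<oplus>\<^bsub>Der K A\<^esub> y \<in> derivations K A"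
  unfolding Der_simps
proof (rule derivationI)
  fix a b assume ab: "a \<in> carrier A" "b \<in> carrier A"
  note closed = derivation_closed [OF assms(1)] derivation_closed [OF assms(2)]
  have "x a \<in> carrier A" "y a \<in> carrier A" "x b \<in> carrier A" "y b \<in> carrier A"
    using ab closed by auto
  note ab = ab this
  show "x (a \<oplus>\<^bsub>A\<^esub> b) \<oplus>\<^bsub>A\<^esub> y (a \<oplus>\<^bsub>A\<^esub> b) = x a \<oplus>\<^bsub>A\<^esub> y a \<oplus>\<^bsub>A\<^esub> (x b \<oplus>\<^bsub>A\<^esub> y b)"
    using ab assms by (simp add: derivation_add A.a_ac)
  show "x (a \<otimes>\<^bsub>A\<^esub> b) \<oplus>\<^bsub>A\<^esub> y (a \<otimes>\<^bsub>A\<^esub> b) = a \<otimes>\<^bsub>A\<^esub> (x b \<oplus>\<^bsub>A\<^esub> y b) \<oplus>\<^bsub>A\<^esub> (x a \<oplus>\<^bsub>A\<^esub> y a) \<otimes>\<^bsub>A\<^esub> b"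
    unfolding derivation_mult [OF assms(1) ab(1,2)] derivation_mult [OF assms(2) ab(1,2)]
    using ab by algebra
qed (use assms in \<open>simp_all add: derivation_smult derivation_closed KA.smult_r_distr\<close>)

lemma derivations_smult:
  assumes c: "c \<in> carrier A" and x: "x \<in> derivations K A"
  shows "c \<odot>\<^bsub>Der K A\<^esub> x \<in> derivations K A"
  unfolding Der_simps
proof (rule derivationI)
  fix a b assume ab: "a \<in> carrier A" "b \<in> carrier A"
  then have xab: "x a \<in> carrier A" "x b \<in> carrier A"
    using derivation_closed [OF x] by auto
  show "c \<otimes>\<^bsub>A\<^esub> x (a \<otimes>\<^bsub>A\<^esub> b) = a \<otimes>\<^bsub>A\<^esub> (c \<otimes>\<^bsub>A\<^esub> x b) \<oplus>\<^bsub>A\<^esub> c \<otimes>\<^bsub>A\<^esub> x a \<otimes>\<^bsub>A\<^esub> b"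
    unfolding derivation_mult [OF x ab] using c ab xab by algebra
qed (use x c in \<open>simp_all add: derivation_add derivation_smult derivation_closed A.r_distr smult_mult_right\<close>)

text \<open>Additive inverses are realised as multiples by -1, so that their closure follows from
  \<open>derivations_smult\<close>.\<close>

lemma derivations_uminus:
  assumes "x \<in> derivations K A"
  shows "(\<ominus>\<^bsub>A\<^esub> \<one>\<^bsub>A\<^esub>) \<odot>\<^bsub>Der K A\<^esub> x \<oplus>\<^bsub>Der K A\<^esub> x = \<zero>\<^bsub>Der K A\<^esub>"
  unfolding Der_simps
proof (rule restrict_ext)
  fix a assume a: "a \<in> carrier A"
  then have "x a \<in> carrier A"
    using assms by (rule derivation_closed [rotated])
  with a show "restrict (\<lambda>a. \<ominus>\<^bsub>A\<^esub> \<one>\<^bsub>A\<^esub> \<otimes>\<^bsub>A\<^esub> x a) (carrier A) a \<oplus>\<^bsub>A\<^esub> x a = \<zero>\<^bsub>A\<^esub>"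
    by (simp add: A.l_minus A.l_neg)
qed

lemma abelian_group_Der: "abelian_group (Der K A)"
proof (rule abelian_groupI)
  fix x assume "x \<in> carrier (Der K A)"
  then show "\<exists>y\<in>carrier (Der K A). y \<oplus>\<^bsub>Der K A\<^esub> x = \<zero>\<^bsub>Der K A\<^esub>"
    using derivations_uminus derivations_smult by (intro bexI [of _ "(\<ominus>\<^bsub>A\<^esub> \<one>\<^bsub>A\<^esub>) \<odot>\<^bsub>Der K A\<^esub> x"]) auto
next
  \<comment> \<open>The left side is restricted to \<open>carrier A\<close>, so equality with
    \<open>x\<close> itself uses that derivations are extensional.\<close>
  fix x assume x: "x \<in> carrier (Der K A)"
  show "\<zero>\<^bsub>Der K A\<^esub> \<oplus>\<^bsub>Der K A\<^esub> x = x"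
    using x derivation_closed [of x] derivation_extensional [of x]
    by (auto intro!: extensionalityI [of _ "carrier A"])
qed (auto intro!: derivations_add [simplified] derivations_zero [simplified] restrict_ext
       simp: derivation_closed A.a_ac simp del: restrict_apply simp: restrict_apply')

lemma comm_group_A: "comm_group (add_monoid A)"
  by (rule A.add.comm_group_axioms)

text \<open>Multiplicativity of the right action is the Leibniz rule in disguise, and
  \<open>balanced\<close> is k-linearity of derivations.\<close>

lemma tensor_action_D1:
  "tensor_action K A (add_monoid A \<times>\<times> add_monoid (Der K A))
     (\<lambda>c (a, x). (c \<otimes>\<^bsub>A\<^esub> a, c \<odot>\<^bsub>Der K A\<^esub> x))
     (\<lambda>(a, x) c. (a \<otimes>\<^bsub>A\<^esub> c \<oplus>\<^bsub>A\<^esub> x c, c \<odot>\<^bsub>Der K A\<^esub> x))"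
proof -
  have G: "comm_group (add_monoid A \<times>\<times> add_monoid (Der K A))"
    by (intro comm_group_DirProd comm_group_A abelian_group.a_comm_group abelian_group_Der)
  show ?thesis
    unfolding tensor_action_def tensor_action_axioms_def
    by (intro conjI allI impI tensor_algebra_axioms G)
      (auto simp: derivations_smult [simplified] derivations_add [simplified] derivation_closed
        derivation_mult derivation_add derivation_smult A.r_distr A.l_distr A.m_ac A.a_ac
        smult_mult_right KA.smult_assoc2 KA.smult_closed intro!: restrict_ext)
qed

lemma smult_D1_tens:
  assumes "a \<in> carrier A" "b \<in> carrier A" "p \<in> carrier A" "x \<in> derivations K A"
  shows "tens K A a b \<odot>\<^bsub>D1 K A f\<^esub> (p, x) =
    (a \<otimes>\<^bsub>A\<^esub> (p \<otimes>\<^bsub>A\<^esub> b \<oplus>\<^bsub>A\<^esub> x b), a \<odot>\<^bsub>Der K A\<^esub> (b \<odot>\<^bsub>Der K A\<^esub> x))"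
  using tensor_action.tensor_act_tens [OF tensor_action_D1, of a b "(p, x)"] assms
  by (simp add: D1_def lr_extension_def)

end


section \<open>The structure of a D-Lie algebra\<close>

locale d_lie = tensor_algebra K A
  for K :: "'k ring" and A :: "('k, 'a) module" +
  fixes f :: "('a \<Rightarrow> 'a) \<Rightarrow> ('a \<Rightarrow> 'a) \<Rightarrow> 'a" and M :: "('a, 'l) dlie"
  assumes D_Lie: "D_Lie_algebra K A f M"
    and dalpha_D: "dalpha M (dD M) = (\<one>\<^bsub>A\<^esub>, \<zero>\<^bsub>Der K A\<^esub>)"
begin

sublocale M: module "tensor_ring K A" M
  using D_Lie unfolding D_Lie_algebra_def P_module_def by blast

definition \<phi> where "\<phi> u = fst (dalpha M u)"

definition scale where "scale a u = tens K A a \<one>\<^bsub>A\<^esub> \<odot>\<^bsub>M\<^esub> u"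

lemma dpi_eq: "u \<in> carrier M \<Longrightarrow> dpi M u = snd (dalpha M u)"
  using D_Lie unfolding D_Lie_algebra_def by blast

lemma dalpha_eq: "u \<in> carrier M \<Longrightarrow> dalpha M u = (\<phi> u, dpi M u)"
  by (simp add: dpi_eq \<phi>_def)

lemma dalpha_hom: "dalpha M \<in> lie_mod_hom (tensor_ring K A) M (D1 K A f)"
  using D_Lie unfolding D_Lie_algebra_def by blast

lemma dalpha_closed: "u \<in> carrier M \<Longrightarrow> dalpha M u \<in> carrier A \<times> derivations K A"
proof -
  assume u: "u \<in> carrier M"
  have "dalpha M \<in> carrier M \<rightarrow> carrier (D1 K A f)"
    using dalpha_hom unfolding lie_mod_hom_def mod_hom_def by blast
  from funcset_mem [OF this u] show ?thesis
    by (simp add: D1_def lr_extension_def)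
qed

lemma \<phi>_closed [simp]: "u \<in> carrier M \<Longrightarrow> \<phi> u \<in> carrier A"
  and dpi_closed [simp]: "u \<in> carrier M \<Longrightarrow> dpi M u \<in> derivations K A"
  using dalpha_closed [of u] by (simp_all add: dalpha_eq)

lemma
  assumes "u \<in> carrier M" "v \<in> carrier M"
  shows \<phi>_add: "\<phi> (u \<oplus>\<^bsub>M\<^esub> v) = \<phi> u \<oplus>\<^bsub>A\<^esub> \<phi> v"
    and dpi_add: "dpi M (u \<oplus>\<^bsub>M\<^esub> v) = dpi M u \<oplus>\<^bsub>Der K A\<^esub> dpi M v"
proof -
  have "dalpha M (u \<oplus>\<^bsub>M\<^esub> v) = dalpha M u \<oplus>\<^bsub>D1 K A f\<^esub> dalpha M v"
    using dalpha_hom assms unfolding lie_mod_hom_def mod_hom_def by blast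
  then show "\<phi> (u \<oplus>\<^bsub>M\<^esub> v) = \<phi> u \<oplus>\<^bsub>A\<^esub> \<phi> v" "dpi M (u \<oplus>\<^bsub>M\<^esub> v) = dpi M u \<oplus>\<^bsub>Der K A\<^esub> dpi M v"
    using assms by (simp_all add: dalpha_eq D1_def lr_extension_def)
qed

text \<open>The evaluation of the action on \<open>D1\<close> turns linearity of
  \<open>dalpha\<close> on a pure tensor into two equations; the first carries the derivation term
  of right multiplication.\<close>

lemma
  assumes "a \<in> carrier A" "b \<in> carrier A" "u \<in> carrier M"
  shows \<phi>_tens: "\<phi> (tens K A a b \<odot>\<^bsub>M\<^esub> u) = a \<otimes>\<^bsub>A\<^esub> (\<phi> u \<otimes>\<^bsub>A\<^esub> b \<oplus>\<^bsub>A\<^esub> dpi M u b)"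
    and dpi_tens: "dpi M (tens K A a b \<odot>\<^bsub>M\<^esub> u) = a \<odot>\<^bsub>Der K A\<^esub> (b \<odot>\<^bsub>Der K A\<^esub> dpi M u)"
proof -
  have "dalpha M (tens K A a b \<odot>\<^bsub>M\<^esub> u) = tens K A a b \<odot>\<^bsub>D1 K A f\<^esub> dalpha M u"
    using dalpha_hom assms tens_closed unfolding lie_mod_hom_def mod_hom_def by blast
  then have "(\<phi> (tens K A a b \<odot>\<^bsub>M\<^esub> u), dpi M (tens K A a b \<odot>\<^bsub>M\<^esub> u)) =
      (a \<otimes>\<^bsub>A\<^esub> (\<phi> u \<otimes>\<^bsub>A\<^esub> b \<oplus>\<^bsub>A\<^esub> dpi M u b), a \<odot>\<^bsub>Der K A\<^esub> (b \<odot>\<^bsub>Der K A\<^esub> dpi M u))"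
    using assms by (simp only: dalpha_eq M.smult_closed tens_closed smult_D1_tens \<phi>_closed dpi_closed)
  then show "\<phi> (tens K A a b \<odot>\<^bsub>M\<^esub> u) = a \<otimes>\<^bsub>A\<^esub> (\<phi> u \<otimes>\<^bsub>A\<^esub> b \<oplus>\<^bsub>A\<^esub> dpi M u b)"
    "dpi M (tens K A a b \<odot>\<^bsub>M\<^esub> u) = a \<odot>\<^bsub>Der K A\<^esub> (b \<odot>\<^bsub>Der K A\<^esub> dpi M u)"
    unfolding prod.inject by blast+
qed

section \<open>Left multiplication by A and the normal form of pure tensors\<close>

lemma scale_closed [simp]: "a \<in> carrier A \<Longrightarrow> u \<in> carrier M \<Longrightarrow> scale a u \<in> carrier M"
  by (simp add: scale_def)

lemma scale_add:
  "a \<in> carrier A \<Longrightarrow> b \<in> carrier A \<Longrightarrow> u \<in> carrier M \<Longrightarrow>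
    scale (a \<oplus>\<^bsub>A\<^esub> b) u = scale a u \<oplus>\<^bsub>M\<^esub> scale b u"
  by (simp add: scale_def tens_add M.smult_l_distr)

lemma scale_distr:
  "a \<in> carrier A \<Longrightarrow> u \<in> carrier M \<Longrightarrow> v \<in> carrier M \<Longrightarrow>
    scale a (u \<oplus>\<^bsub>M\<^esub> v) = scale a u \<oplus>\<^bsub>M\<^esub> scale a v"
  by (simp add: scale_def M.smult_r_distr)

lemma scale_scale:
  "a \<in> carrier A \<Longrightarrow> b \<in> carrier A \<Longrightarrow> u \<in> carrier M \<Longrightarrow> scale a (scale b u) = scale (a \<otimes>\<^bsub>A\<^esub> b) u"
  using tens_mult [of a "\<one>\<^bsub>A\<^esub>" b "\<one>\<^bsub>A\<^esub>"] by (simp add: scale_def flip: M.smult_assoc1)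

lemma scale_one: "u \<in> carrier M \<Longrightarrow> scale \<one>\<^bsub>A\<^esub> u = u"
  by (simp add: scale_def tens_one)

lemma scale_zero:
  assumes u: "u \<in> carrier M"
  shows "scale \<zero>\<^bsub>A\<^esub> u = \<zero>\<^bsub>M\<^esub>"
proof -
  have "scale \<zero>\<^bsub>A\<^esub> u \<oplus>\<^bsub>M\<^esub> scale \<zero>\<^bsub>A\<^esub> u = scale \<zero>\<^bsub>A\<^esub> u"
    using u by (simp flip: scale_add)
  then show ?thesis
    using u by (metis M.add.l_cancel_one A.zero_closed scale_closed)
qed

lemma scale_minus:
  assumes "a \<in> carrier A" "u \<in> carrier M"
  shows "\<ominus>\<^bsub>M\<^esub> scale a u = scale (\<ominus>\<^bsub>A\<^esub> a) u"
  using assms by (intro M.minus_equality) (simp_all add: A.l_neg scale_zero flip: scale_add)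

text \<open>A derivation vanishes at 1, so the twisted formula for a \<otimes> 1 loses its
  derivation term and becomes plain linearity.\<close>

lemma
  assumes "a \<in> carrier A" "u \<in> carrier M"
  shows \<phi>_scale: "\<phi> (scale a u) = a \<otimes>\<^bsub>A\<^esub> \<phi> u"
    and dpi_scale: "dpi M (scale a u) = a \<odot>\<^bsub>Der K A\<^esub> dpi M u"
proof -
  show "\<phi> (scale a u) = a \<otimes>\<^bsub>A\<^esub> \<phi> u"
    using assms \<phi>_tens [of a "\<one>\<^bsub>A\<^esub>" u] by (simp add: scale_def derivation_one)
  have "\<one>\<^bsub>A\<^esub> \<odot>\<^bsub>Der K A\<^esub> dpi M u = dpi M u"
    using derivation_extensional [OF dpi_closed] derivation_closed [OF dpi_closed] assms
    by (auto intro!: extensionalityI [of _ "carrier A"])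
  then show "dpi M (scale a u) = a \<odot>\<^bsub>Der K A\<^esub> dpi M u"
    using assms dpi_tens [of a "\<one>\<^bsub>A\<^esub>" u] by (simp add: scale_def del: Der_simps)
qed

lemma D_closed [simp]: "dD M \<in> carrier M"
  using D_Lie unfolding D_Lie_algebra_def by blast

lemma dpi_D: "dpi M (dD M) = \<zero>\<^bsub>Der K A\<^esub>"
  using D_Lie unfolding D_Lie_algebra_def by blast

lemma \<phi>_D: "\<phi> (dD M) = \<one>\<^bsub>A\<^esub>"
  by (simp add: \<phi>_def dalpha_D)

lemma dpi_scale_D: "a \<in> carrier A \<Longrightarrow> dpi M (scale a (dD M)) = \<zero>\<^bsub>Der K A\<^esub>"
  by (simp add: dpi_scale dpi_D cong: restrict_cong)

lemma dpi_scale_D_add: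
  assumes "a \<in> carrier A" "u \<in> carrier M"
  shows "dpi M (scale a (dD M) \<oplus>\<^bsub>M\<^esub> u) = dpi M u"
proof -
  interpret Der: abelian_group "Der K A" by (rule abelian_group_Der)
  show ?thesis
    using Der.l_zero [of "dpi M u"] assms by (simp add: dpi_add dpi_scale_D del: Der_simps(2,3))
qed

text \<open>Write 1 \<otimes> b as \<open>tens_diff K A b\<close> plus b \<otimes> 1. The first
  summand sends \<open>u\<close> into the multiples of \<open>D\<close>, so a pure tensor acts by
  left multiplications up to \<open>J\<close>.\<close>

lemma tens_eq_scale:
  assumes a: "a \<in> carrier A" and b: "b \<in> carrier A" and u: "u \<in> carrier M"
  shows "tens K A a b \<odot>\<^bsub>M\<^esub> u = scale (a \<otimes>\<^bsub>A\<^esub> dpi M u b) (dD M) \<oplus>\<^bsub>M\<^esub> scale a (scale b u)"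
proof -
  have dpi: "dpi M u b \<in> carrier A"
    using derivation_closed [OF dpi_closed] b u by simp
  have "tens_diff K A b \<odot>\<^bsub>M\<^esub> u = scale (dpi M u b) (dD M)"
    using D_Lie u b unfolding D_Lie_algebra_def scale_def by blast
  moreover have "tens K A \<one>\<^bsub>A\<^esub> b = tens_diff K A b \<oplus>\<^bsub>tensor_ring K A\<^esub> tens K A b \<one>\<^bsub>A\<^esub>"
    using b unfolding tens_diff_def a_minus_def by (simp add: TR.a_assoc TR.l_neg)
  moreover have "tens_diff K A b \<in> carrier (tensor_ring K A)"
    using b unfolding tens_diff_def by simp
  ultimately have "tens K A \<one>\<^bsub>A\<^esub> b \<odot>\<^bsub>M\<^esub> u = scale (dpi M u b) (dD M) \<oplus>\<^bsub>M\<^esub> scale b u"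
    using b u by (simp add: M.smult_l_distr scale_def)
  moreover have "tens K A a b \<odot>\<^bsub>M\<^esub> u = scale a (tens K A \<one>\<^bsub>A\<^esub> b \<odot>\<^bsub>M\<^esub> u)"
    using tens_mult [of a "\<one>\<^bsub>A\<^esub>" "\<one>\<^bsub>A\<^esub>" b] a b u by (simp add: scale_def flip: M.smult_assoc1)
  ultimately show ?thesis
    using a b u dpi by (simp add: scale_distr scale_scale)
qed

section \<open>The Lie bracket and its components\<close>

lemma lie: "lie_algebra K (restrict_scalars (\<lambda>c. tens K A (c \<odot>\<^bsub>A\<^esub> \<one>\<^bsub>A\<^esub>) \<one>\<^bsub>A\<^esub>) M)"
  using D_Lie unfolding D_Lie_algebra_def by blast

lemma bracket_closed [simp]: "u \<in> carrier M \<Longrightarrow> v \<in> carrier M \<Longrightarrow> bracket M u v \<in> carrier M"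
  using lie by (simp add: lie_algebra_def restrict_scalars_def)

lemma bracket_add:
  assumes "u \<in> carrier M" "v \<in> carrier M" "w \<in> carrier M"
  shows "bracket M (u \<oplus>\<^bsub>M\<^esub> v) w = bracket M u w \<oplus>\<^bsub>M\<^esub> bracket M v w"
    and "bracket M u (v \<oplus>\<^bsub>M\<^esub> w) = bracket M u v \<oplus>\<^bsub>M\<^esub> bracket M u w"
  using lie assms by (simp_all add: lie_algebra_def restrict_scalars_def)

lemma bracket_self: "u \<in> carrier M \<Longrightarrow> bracket M u u = \<zero>\<^bsub>M\<^esub>"
  using lie by (simp add: lie_algebra_def restrict_scalars_def)

lemma bracket_antisym:
  assumes u: "u \<in> carrier M" and v: "v \<in> carrier M"
  shows "bracket M u v = \<ominus>\<^bsub>M\<^esub> bracket M v u"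
proof -
  have "\<zero>\<^bsub>M\<^esub> = bracket M (u \<oplus>\<^bsub>M\<^esub> v) (u \<oplus>\<^bsub>M\<^esub> v)"
    using u v by (simp only: bracket_self M.a_closed)
  also have "\<dots> = (bracket M u u \<oplus>\<^bsub>M\<^esub> bracket M v u) \<oplus>\<^bsub>M\<^esub> (bracket M u v \<oplus>\<^bsub>M\<^esub> bracket M v v)"
    using u v by (simp only: bracket_add M.a_closed)
  also have "\<dots> = bracket M u v \<oplus>\<^bsub>M\<^esub> bracket M v u"
    using u v by (simp add: bracket_self M.a_comm)
  finally have "bracket M u v \<oplus>\<^bsub>M\<^esub> bracket M v u = \<zero>\<^bsub>M\<^esub>" ..
  then show ?thesis
    using u v by (intro M.minus_equality [symmetric]) auto
qed

text \<open>Since \<open>D\<close> is central, only the anchor term of the Leibniz rule survives. So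
  \<open>J\<close> is a Lie ideal, and the explicit coefficients serve as witnesses for the bracket
  on the quotient.\<close>

lemma bracket_scale_D:
  assumes u: "u \<in> carrier M" and a: "a \<in> carrier A"
  shows "bracket M u (scale a (dD M)) = scale (dpi M u a) (dD M)"
    and "bracket M (scale a (dD M)) u = scale (\<ominus>\<^bsub>A\<^esub> dpi M u a) (dD M)"
proof -
  have dpi: "dpi M u a \<in> carrier A"
    using derivation_closed [OF dpi_closed] a u by simp
  have "bracket M (dD M) u = \<zero>\<^bsub>M\<^esub>"
    using D_Lie u unfolding D_Lie_algebra_def by blast
  then have "bracket M u (dD M) = \<zero>\<^bsub>M\<^esub>"
    using bracket_antisym [of u "dD M"] u by simp
  moreover have "bracket M u (scale a (dD M)) =
      scale a (bracket M u (dD M)) \<oplus>\<^bsub>M\<^esub> scale (dpi M u a) (dD M)"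
    using D_Lie u a D_closed unfolding D_Lie_algebra_def scale_def by blast
  ultimately show *: "bracket M u (scale a (dD M)) = scale (dpi M u a) (dD M)"
    using a dpi by (simp add: scale_def)
  then show "bracket M (scale a (dD M)) u = scale (\<ominus>\<^bsub>A\<^esub> dpi M u a) (dD M)"
    using bracket_antisym [of "scale a (dD M)" u] u a dpi by (simp add: scale_minus)
qed

lemma
  assumes "u \<in> carrier M" "v \<in> carrier M"
  shows \<phi>_bracket: "\<phi> (bracket M u v) =
      dpi M u (\<phi> v) \<ominus>\<^bsub>A\<^esub> dpi M v (\<phi> u) \<oplus>\<^bsub>A\<^esub> f (dpi M u) (dpi M v)"
    and dpi_bracket: "dpi M (bracket M u v) = bracket (Der K A) (dpi M u) (dpi M v)"
proof -
  have "dalpha M (bracket M u v) = bracket (D1 K A f) (dalpha M u) (dalpha M v)"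
    using dalpha_hom assms unfolding lie_mod_hom_def by blast
  then show "\<phi> (bracket M u v) =
      dpi M u (\<phi> v) \<ominus>\<^bsub>A\<^esub> dpi M v (\<phi> u) \<oplus>\<^bsub>A\<^esub> f (dpi M u) (dpi M v)"
    "dpi M (bracket M u v) = bracket (Der K A) (dpi M u) (dpi M v)"
    using assms by (simp_all add: dalpha_eq D1_def lr_extension_def)
qed


section \<open>The canonical quotient\<close>

abbreviation J where "J \<equiv> D_submodule K A M"

lemma J_iff: "u \<in> J \<longleftrightarrow> (\<exists>a\<in>carrier A. u = scale a (dD M))"
  by (auto simp: D_submodule_def scale_def)

sublocale J: abelian_subgroup J M
proof (rule abelian_subgroupI3)
  show "additive_subgroup J M"
  proof (rule additive_subgroup.intro, rule group.subgroupI [OF M.a_group])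
    show "J \<noteq> {}"
      using J_iff A.zero_closed by blast
  next
    fix u assume "u \<in> J"
    then show "inv\<^bsub>add_monoid M\<^esub> u \<in> J"
      by (auto simp: J_iff scale_minus simp flip: a_inv_def)
  next
    fix u v assume "u \<in> J" "v \<in> J"
    then show "u \<otimes>\<^bsub>add_monoid M\<^esub> v \<in> J"
      by (auto simp: J_iff simp flip: scale_add)
  qed (auto simp: J_iff)
qed (rule M.abelian_group_axioms)

abbreviation quot where "quot u \<equiv> J +>\<^bsub>M\<^esub> u"
abbreviation L where "L \<equiv> canonical_quotient K A M"

lemma quot_mem: "v \<in> quot u \<longleftrightarrow> (\<exists>a\<in>carrier A. v = scale a (dD M) \<oplus>\<^bsub>M\<^esub> u)"
proof -
  have "v \<in> quot u \<longleftrightarrow> (\<exists>x\<in>J. v = x \<oplus>\<^bsub>M\<^esub> u)"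
    unfolding a_r_coset_def' by simp
  then show ?thesis
    unfolding Bex_def J_iff by blast
qed

lemma quot_eqI:
  assumes "a \<in> carrier A" "u \<in> carrier M" "v = scale a (dD M) \<oplus>\<^bsub>M\<^esub> u"
  shows "quot v = quot u"
  using J.a_repr_independence' [of v u] assms quot_mem by blast

lemma quot_eqE:
  assumes "quot v = quot u" "v \<in> carrier M"
  obtains a where "a \<in> carrier A" "v = scale a (dD M) \<oplus>\<^bsub>M\<^esub> u"
  using J.a_rcos_self [of v] assms quot_mem [of v u] by auto

lemma carrier_L: "carrier L = quot ` carrier M"
  unfolding canonical_quotient_def Let_def A_RCOSETS_def' a_r_coset_def' by auto

lemma quot_add:
  "u \<in> carrier M \<Longrightarrow> v \<in> carrier M \<Longrightarrow> quot u \<oplus>\<^bsub>L\<^esub> quot v = quot (u \<oplus>\<^bsub>M\<^esub> v)"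
  by (simp add: canonical_quotient_def Let_def J.a_rcos_sum)

text \<open>The operations of the quotient are unions over all representatives; such a union
  collapses once its members coincide.\<close>

lemma quot_const:
  assumes u: "u \<in> carrier M"
    and h: "\<And>v. v \<in> quot u \<Longrightarrow> h v = h u"
  shows "(\<Union>v\<in>quot u. h v) = h u"
  using h J.a_rcos_self [OF u] by blast

lemma quot_smult:
  assumes a: "a \<in> carrier A" and u: "u \<in> carrier M"
  shows "a \<odot>\<^bsub>L\<^esub> quot u = quot (scale a u)"
proof -
  have "(\<Union>v\<in>quot u. quot (scale a v)) = quot (scale a u)"
  proof (rule quot_const [OF u])
    fix v assume "v \<in> quot u"
    then obtain b where "b \<in> carrier A" "v = scale b (dD M) \<oplus>\<^bsub>M\<^esub> u"
      using quot_mem by blast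
    with a u show "quot (scale a v) = quot (scale a u)"
      by (intro quot_eqI [of "a \<otimes>\<^bsub>A\<^esub> b"]) (simp_all add: scale_distr scale_scale)
  qed
  then show ?thesis
    by (simp add: canonical_quotient_def Let_def scale_def)
qed

text \<open>Independence of representatives is shown one variable at a time, in the second argument
  for every \<open>x\<close>, then in the first with \<open>v\<close> fixed.\<close>

lemma quot_bracket:
  assumes u: "u \<in> carrier M" and v: "v \<in> carrier M"
  shows "bracket L (quot u) (quot v) = quot (bracket M u v)"
proof -
  have right: "(\<Union>y\<in>quot v. quot (bracket M x y)) = quot (bracket M x v)" if x: "x \<in> carrier M" for x
  proof (rule quot_const [OF v])
    fix y assume "y \<in> quot v"
    then obtain b where "b \<in> carrier A" "y = scale b (dD M) \<oplus>\<^bsub>M\<^esub> v"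
      using quot_mem by blast
    \<comment> \<open>[x, bD + v] = \<pi>(x)(b) D + [x, v] supplies the coefficient.\<close>
    with x v show "quot (bracket M x y) = quot (bracket M x v)"
      by (intro quot_eqI [of "dpi M x b"])
        (simp_all add: bracket_add bracket_scale_D derivation_closed)
  qed
  have "(\<Union>x\<in>quot u. quot (bracket M x v)) = quot (bracket M u v)"
  proof (rule quot_const [OF u])
    fix x assume "x \<in> quot u"
    then obtain b where "b \<in> carrier A" "x = scale b (dD M) \<oplus>\<^bsub>M\<^esub> u"
      using quot_mem by blast
    \<comment> \<open>[bD + u, v] = -\<pi>(v)(b) D + [u, v], with the sign from
      antisymmetry.\<close>
    with u v show "quot (bracket M x v) = quot (bracket M u v)"
      by (intro quot_eqI [of "\<ominus>\<^bsub>A\<^esub> dpi M v b"])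
        (simp_all add: bracket_add bracket_scale_D derivation_closed)
  qed
  moreover have "x \<in> carrier M" if "x \<in> quot u" for x
    using J.a_elemrcos_carrier [OF u that] .
  ultimately show ?thesis
    by (simp add: canonical_quotient_def Let_def right cong: SUP_cong)
qed

lemma quot_anchor:
  assumes u: "u \<in> carrier M"
  shows "anchor L (quot u) = dpi M u"
proof -
  have val: "dpi M v = dpi M u" if "v \<in> quot u" for v
    using that u dpi_scale_D_add by (auto simp: quot_mem)
  have "dpi M ` quot u = {dpi M u}"
    using J.a_rcos_self [OF u]
    by (subst image_cong [OF refl val]) auto
  then show ?thesis
    by (simp add: canonical_quotient_def Let_def)
qed

lemma zero_L: "\<zero>\<^bsub>L\<^esub> = quot \<zero>\<^bsub>M\<^esub>"
  using J.a_rcos_const [OF J.zero_closed] by (simp add: canonical_quotient_def Let_def)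

text \<open>The action on A \<oplus> L is a finite product in its additive group, so this group must
  be commutative; the laws pass from \<open>M\<close> along \<open>quot\<close>.\<close>

lemma comm_group_L: "comm_group (add_monoid L)"
proof (rule abelian_group.a_comm_group, rule abelian_groupI)
  fix X assume "X \<in> carrier L"
  then obtain u where u: "u \<in> carrier M" "X = quot u"
    by (auto simp: carrier_L)
  then show "\<exists>Y\<in>carrier L. Y \<oplus>\<^bsub>L\<^esub> X = \<zero>\<^bsub>L\<^esub>"
    by (intro bexI [of _ "quot (\<ominus>\<^bsub>M\<^esub> u)"]) (simp_all add: carrier_L quot_add zero_L M.l_neg)
qed (auto simp: carrier_L quot_add zero_L M.a_ac)

end


section \<open>The comparison isomorphism\<close>

lemma D_extension_simps [simp]:
  "carrier (D_extension A f L) = carrier A \<times> carrier L"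
  "(a, x) \<oplus>\<^bsub>D_extension A f L\<^esub> (b, y) = (a \<oplus>\<^bsub>A\<^esub> b, x \<oplus>\<^bsub>L\<^esub> y)"
  "bracket (D_extension A f L) (a, x) (b, y) =
    (anchor L x b \<ominus>\<^bsub>A\<^esub> anchor L y a \<oplus>\<^bsub>A\<^esub> f (anchor L x) (anchor L y), bracket L x y)"
  "dpi (D_extension A f L) (a, x) = anchor L x"
  "dD (D_extension A f L) = (\<one>\<^bsub>A\<^esub>, \<zero>\<^bsub>L\<^esub>)"
  by (simp_all add: D_extension_def lr_extension_def bracket_module.defs dlie.defs pullback_def)

lemma smult_D_extension:
  "t \<odot>\<^bsub>D_extension A f L\<^esub> u = tensor_act (add_monoid A \<times>\<times> add_monoid L)
    (\<lambda>c (a, x). (c \<otimes>\<^bsub>A\<^esub> a, c \<odot>\<^bsub>L\<^esub> x))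
    (\<lambda>(a, x) c. (a \<otimes>\<^bsub>A\<^esub> c \<oplus>\<^bsub>A\<^esub> anchor L x c, c \<odot>\<^bsub>L\<^esub> x)) t u"
  by (simp add: D_extension_def lr_extension_def bracket_module.defs dlie.defs)

context d_lie
begin

lemma quot_closed [simp]: "u \<in> carrier M \<Longrightarrow> quot u \<in> carrier L"
  by (simp add: carrier_L)

text \<open>Left and right multiplication differ by an element of \<open>J\<close>, so on the
  quotient both become the same scalar multiplication.\<close>

lemma quot_tens:
  assumes "a \<in> carrier A" "b \<in> carrier A" "u \<in> carrier M"
  shows "quot (tens K A a b \<odot>\<^bsub>M\<^esub> u) = a \<odot>\<^bsub>L\<^esub> (b \<odot>\<^bsub>L\<^esub> quot u)"
proof -
  have "dpi M u b \<in> carrier A"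
    using assms derivation_closed by simp
  then have "quot (tens K A a b \<odot>\<^bsub>M\<^esub> u) = quot (scale a (scale b u))"
    using assms by (intro quot_eqI [of "a \<otimes>\<^bsub>A\<^esub> dpi M u b"]) (simp_all add: tens_eq_scale)
  then show ?thesis
    using assms by (simp add: quot_smult)
qed

lemma quot_D: "quot (dD M) = \<zero>\<^bsub>L\<^esub>"
  unfolding zero_L by (rule quot_eqI [of "\<one>\<^bsub>A\<^esub>"]) (simp_all add: scale_one)

text \<open>The first component of the comparison map is corrected by a 1-cochain \<open>g\<close>, which
  accounts for replacing \<open>f\<close> by a cohomologous cocycle.\<close>

lemma isomorphic_D_extension:
  fixes L' :: "('a, 'n) lie_rinehart"
  assumes L': "comm_group (add_monoid L')" and \<theta>: "lr_iso A L L' \<theta>"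
    and f: "\<And>x y. x \<in> derivations K A \<Longrightarrow> y \<in> derivations K A \<Longrightarrow> f x y \<in> carrier A"
    and g: "g \<in> lr_C1 A (Der K A)"
    and f': "\<And>x y. x \<in> derivations K A \<Longrightarrow> y \<in> derivations K A \<Longrightarrow>
      f' x y = f x y \<oplus>\<^bsub>A\<^esub> lr_d1 A (Der K A) g x y"
  shows "D_Lie_isomorphic K A M (D_extension A f' L')"
proof -
  let ?N = "D_extension A f' L'"
  define h where "h u = \<phi> u \<ominus>\<^bsub>A\<^esub> g (dpi M u)" for u
  define \<Phi> where "\<Phi> u = (h u, \<theta> (quot u))" for u
  have g_closed: "g x \<in> carrier A" if "x \<in> derivations K A" for x
    using g that by (auto simp: lr_C1_def)
  have g_add: "g (x \<oplus>\<^bsub>Der K A\<^esub> y) = g x \<oplus>\<^bsub>A\<^esub> g y" if "x \<in> derivations K A" "y \<in> derivations K A" for x y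
    using g that unfolding lr_C1_def Der_simps(1) by blast
  have g_smult: "g (a \<odot>\<^bsub>Der K A\<^esub> x) = a \<otimes>\<^bsub>A\<^esub> g x" if "a \<in> carrier A" "x \<in> derivations K A" for a x
    using g that unfolding lr_C1_def Der_simps(1) by blast
  have h_closed: "h u \<in> carrier A" if "u \<in> carrier M" for u
    using that g_closed by (simp add: h_def)
  have h_add: "h (u \<oplus>\<^bsub>M\<^esub> v) = h u \<oplus>\<^bsub>A\<^esub> h v" if u: "u \<in> carrier M" and v: "v \<in> carrier M" for u v
  proof -
    have "\<phi> u \<in> carrier A" "\<phi> v \<in> carrier A" "g (dpi M u) \<in> carrier A" "g (dpi M v) \<in> carrier A"
      using u v g_closed by auto
    then show ?thesis
      unfolding h_def \<phi>_add [OF u v] dpi_add [OF u v] g_add [OF dpi_closed [OF u] dpi_closed [OF v]]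
      by algebra
  qed
  \<comment> \<open>Left and right multiplication agree on derivations, so \<open>g\<close> composed
    with \<open>dpi M\<close> is linear for both. Subtracting it leaves the derivation term
    unchanged.\<close>
  have h_tens: "h (tens K A a b \<odot>\<^bsub>M\<^esub> u) = a \<otimes>\<^bsub>A\<^esub> (h u \<otimes>\<^bsub>A\<^esub> b \<oplus>\<^bsub>A\<^esub> dpi M u b)"
    if ab: "a \<in> carrier A" "b \<in> carrier A" and u: "u \<in> carrier M" for a b u
  proof -
    have closed: "\<phi> u \<in> carrier A" "g (dpi M u) \<in> carrier A" "dpi M u b \<in> carrier A"
      using u ab g_closed derivation_closed by auto
    have "g (a \<odot>\<^bsub>Der K A\<^esub> (b \<odot>\<^bsub>Der K A\<^esub> dpi M u)) = a \<otimes>\<^bsub>A\<^esub> (b \<otimes>\<^bsub>A\<^esub> g (dpi M u))"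
      using ab u by (simp only: g_smult derivations_smult dpi_closed)
    then show ?thesis
      unfolding h_def \<phi>_tens [OF ab u] dpi_tens [OF ab u] using ab closed by algebra
  qed
  \<comment> \<open>The terms with \<open>g\<close> inside a derivation cancel against the first two
    terms of \<open>lr_d1\<close>; its last term is the correction in
    \<open>h (bracket M u v)\<close>.\<close>
  have h_bracket: "h (bracket M u v) =
      dpi M u (h v) \<ominus>\<^bsub>A\<^esub> dpi M v (h u) \<oplus>\<^bsub>A\<^esub> f' (dpi M u) (dpi M v)"
    if u: "u \<in> carrier M" and v: "v \<in> carrier M" for u v
  proof -
    let ?x = "dpi M u" and ?y = "dpi M v"
    have xy: "?x \<in> derivations K A" "?y \<in> derivations K A" "bracket (Der K A) ?x ?y \<in> derivations K A"
      using u v dpi_closed [OF bracket_closed [OF u v]] by (simp_all add: dpi_bracket)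
    note closed = f [OF xy(1,2)] g_closed [OF xy(3)]
      derivation_closed [OF xy(1) \<phi>_closed [OF v]] derivation_closed [OF xy(2) \<phi>_closed [OF u]]
      derivation_closed [OF xy(1) g_closed [OF xy(2)]] derivation_closed [OF xy(2) g_closed [OF xy(1)]]
    have h_v: "?x (h v) = ?x (\<phi> v) \<ominus>\<^bsub>A\<^esub> ?x (g ?y)" and h_u: "?y (h u) = ?y (\<phi> u) \<ominus>\<^bsub>A\<^esub> ?y (g ?x)"
      unfolding h_def using u v xy g_closed by (simp_all add: derivation_diff)
    have f'_xy: "f' ?x ?y = f ?x ?y \<oplus>\<^bsub>A\<^esub> (?x (g ?y) \<ominus>\<^bsub>A\<^esub> ?y (g ?x) \<ominus>\<^bsub>A\<^esub> g (bracket (Der K A) ?x ?y))"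
      using f' [OF xy(1,2)] by (simp add: lr_d1_def)
    have h_uv: "h (bracket M u v) = (?x (\<phi> v) \<ominus>\<^bsub>A\<^esub> ?y (\<phi> u) \<oplus>\<^bsub>A\<^esub> f ?x ?y) \<ominus>\<^bsub>A\<^esub> g (bracket (Der K A) ?x ?y)"
      unfolding h_def \<phi>_bracket [OF u v] dpi_bracket [OF u v] ..
    show ?thesis
      unfolding h_v h_u f'_xy h_uv using closed by algebra
  qed
  \<comment> \<open>As \<open>dpi M\<close> kills \<open>J\<close>, the correction by
    \<open>g\<close> vanishes there, and \<open>h\<close> still inverts the map from a to
    aD.\<close>
  have h_scale_D: "h (scale a (dD M)) = a" if a: "a \<in> carrier A" for a
  proof -
    \<comment> \<open>The zero derivation is written as a multiple by 0 so that linearity of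
      \<open>g\<close> gives its value there.\<close>
    have z: "\<zero>\<^bsub>Der K A\<^esub> = \<zero>\<^bsub>A\<^esub> \<odot>\<^bsub>Der K A\<^esub> dpi M (dD M)"
      unfolding Der_simps
      by (rule restrict_ext) (simp add: derivation_closed [OF dpi_closed [OF D_closed]])
    have "g (\<zero>\<^bsub>Der K A\<^esub>) = \<zero>\<^bsub>A\<^esub> \<otimes>\<^bsub>A\<^esub> g (dpi M (dD M))"
      unfolding z by (rule g_smult) simp_all
    then have "g (\<zero>\<^bsub>Der K A\<^esub>) = \<zero>\<^bsub>A\<^esub>"
      using g_closed [OF dpi_closed [OF D_closed]] by simp
    then show ?thesis
      using a by (simp add: h_def \<phi>_scale \<phi>_D dpi_scale_D a_minus_def del: Der_simps)
  qed
  have \<theta>_bij: "bij_betw \<theta> (carrier L) (carrier L')"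
    and \<theta>_anchor: "\<And>x. x \<in> carrier L \<Longrightarrow> anchor L' (\<theta> x) = anchor L x"
    and \<theta>_hom: "\<theta> \<in> lie_mod_hom A L L'"
    using \<theta> unfolding lr_iso_def by blast+
  then have \<theta>_closed: "\<And>x. x \<in> carrier L \<Longrightarrow> \<theta> x \<in> carrier L'"
    by (simp add: bij_betw_apply)
  have \<theta>_add: "\<theta> (x \<oplus>\<^bsub>L\<^esub> y) = \<theta> x \<oplus>\<^bsub>L'\<^esub> \<theta> y" if "x \<in> carrier L" "y \<in> carrier L" for x y
    using \<theta>_hom that unfolding lie_mod_hom_def mod_hom_def by blast
  have \<theta>_smult: "\<theta> (a \<odot>\<^bsub>L\<^esub> x) = a \<odot>\<^bsub>L'\<^esub> \<theta> x" if "a \<in> carrier A" "x \<in> carrier L" for a x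
    using \<theta>_hom that unfolding lie_mod_hom_def mod_hom_def by blast
  have \<theta>_bracket: "\<theta> (bracket L x y) = bracket L' (\<theta> x) (\<theta> y)" if "x \<in> carrier L" "y \<in> carrier L" for x y
    using \<theta>_hom that unfolding lie_mod_hom_def by blast
  have anchor: "anchor L' (\<theta> (quot u)) = dpi M u" if "u \<in> carrier M" for u
    using that by (simp add: \<theta>_anchor quot_anchor)
  have \<theta>_zero: "\<theta> \<zero>\<^bsub>L\<^esub> = \<zero>\<^bsub>L'\<^esub>"
  proof -
    interpret LG: comm_group "add_monoid L" by (rule comm_group_L)
    interpret LG': comm_group "add_monoid L'" by (rule L')
    interpret group_hom "add_monoid L" "add_monoid L'" \<theta>
      by unfold_locales (auto simp: hom_def \<theta>_closed \<theta>_add)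
    show ?thesis
      using hom_one by simp
  qed
  have add: "\<Phi> (u \<oplus>\<^bsub>M\<^esub> v) = \<Phi> u \<oplus>\<^bsub>?N\<^esub> \<Phi> v" if "u \<in> carrier M" "v \<in> carrier M" for u v
    using that by (simp add: \<Phi>_def h_add \<theta>_add flip: quot_add)
  \<comment> \<open>Pure tensors suffice: \<open>hom_tensor_act\<close> carries the action of
    \<open>M\<close> over and settles the choice of representatives in the target.\<close>
  have smult: "\<Phi> (t \<odot>\<^bsub>M\<^esub> u) = t \<odot>\<^bsub>?N\<^esub> \<Phi> u"
    if t: "t \<in> carrier (tensor_ring K A)" and u: "u \<in> carrier M" for t u
    unfolding smult_D_extension
  proof (rule hom_tensor_act [OF M.module_axioms _ _ _ t u])
    show "comm_group (add_monoid A \<times>\<times> add_monoid L')"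
      by (intro comm_group_DirProd comm_group_A L')
    show "\<Phi> \<in> hom (add_monoid M) (add_monoid A \<times>\<times> add_monoid L')"
      by (auto simp: hom_def \<Phi>_def h_add h_closed \<theta>_closed \<theta>_add simp flip: quot_add)
  next
    fix a b assume ab: "a \<in> carrier A" "b \<in> carrier A"
    moreover have "b \<odot>\<^bsub>L\<^esub> quot u \<in> carrier L"
      using ab u by (simp add: quot_smult)
    ultimately show "\<Phi> (tens K A a b \<odot>\<^bsub>M\<^esub> u) = (\<lambda>(p, x). (a \<otimes>\<^bsub>A\<^esub> p, a \<odot>\<^bsub>L'\<^esub> x))
        ((\<lambda>(p, x) c. (p \<otimes>\<^bsub>A\<^esub> c \<oplus>\<^bsub>A\<^esub> anchor L' x c, c \<odot>\<^bsub>L'\<^esub> x)) (\<Phi> u) b)"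
      using u by (simp add: \<Phi>_def h_tens quot_tens \<theta>_smult anchor)
  qed
  have "\<Phi> \<in> D_Lie_hom K A M ?N"
    unfolding D_Lie_hom_def lie_mod_hom_def mod_hom_def
  proof (intro CollectI conjI ballI funcsetI)
    fix u v assume "u \<in> carrier M" "v \<in> carrier M"
    then show "\<Phi> (bracket M u v) = bracket ?N (\<Phi> u) (\<Phi> v)"
      by (simp add: \<Phi>_def h_bracket anchor \<theta>_bracket flip: quot_bracket)
  next
    show "\<Phi> (dD M) = dD ?N"
      using h_scale_D [of "\<one>\<^bsub>A\<^esub>"] by (simp add: \<Phi>_def scale_one quot_D \<theta>_zero)
  qed (use add smult in \<open>simp_all add: \<Phi>_def h_closed \<theta>_closed anchor\<close>)
  moreover have "bij_betw \<Phi> (carrier M) (carrier ?N)"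
    unfolding bij_betw_def
  proof (intro conjI inj_onI equalityI subsetI)
    fix u v assume u: "u \<in> carrier M" and v: "v \<in> carrier M" and eq: "\<Phi> u = \<Phi> v"
    have "quot u = quot v"
      using eq u v \<theta>_bij by (auto simp: \<Phi>_def bij_betw_def dest: inj_onD)
    then obtain a where a: "a \<in> carrier A" "u = scale a (dD M) \<oplus>\<^bsub>M\<^esub> v"
      using u by (rule quot_eqE)
    \<comment> \<open>The classes agree, so \<open>u\<close> and \<open>v\<close> differ by aD, and
      the first component detects a.\<close>
    then have "a \<oplus>\<^bsub>A\<^esub> h v = h v"
      using eq v by (simp add: \<Phi>_def h_add h_scale_D)
    then have "a = \<zero>\<^bsub>A\<^esub>"
      using a v h_closed by (metis A.add.r_cancel_one)
    then show "u = v"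
      using a v by (simp add: scale_zero)
  next
    fix w assume "w \<in> \<Phi> ` carrier M"
    then show "w \<in> carrier ?N"
      by (auto simp: \<Phi>_def h_closed \<theta>_closed)
  next
    fix w assume "w \<in> carrier ?N"
    then obtain b Y where b: "b \<in> carrier A" and Y: "Y \<in> carrier L'" and "w = (b, Y)"
      by auto
    moreover from Y obtain X where "X \<in> carrier L" "Y = \<theta> X"
      using \<theta>_bij by (auto simp: bij_betw_def)
    moreover from this obtain u where u: "u \<in> carrier M" "X = quot u"
      by (auto simp: carrier_L)
    ultimately have w: "w = (b, \<theta> (quot u))"
      by simp
    \<comment> \<open>The lift \<open>u\<close> has the right class; adding a multiple of
      \<open>D\<close> corrects the first component without changing the class.\<close>
    define v where "v = scale (b \<ominus>\<^bsub>A\<^esub> h u) (dD M) \<oplus>\<^bsub>M\<^esub> u"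
    have "b \<ominus>\<^bsub>A\<^esub> h u \<in> carrier A"
      using b u h_closed by simp
    moreover from this have "h v = (b \<ominus>\<^bsub>A\<^esub> h u) \<oplus>\<^bsub>A\<^esub> h u"
      using u by (simp add: v_def h_add h_scale_D)
    moreover have "(b \<ominus>\<^bsub>A\<^esub> h u) \<oplus>\<^bsub>A\<^esub> h u = b"
      using b h_closed [OF u(1)] by algebra
    ultimately have "v \<in> carrier M" "\<Phi> v = w"
      using u quot_eqI [of "b \<ominus>\<^bsub>A\<^esub> h u" u v] by (simp_all add: \<Phi>_def w v_def)
    then show "w \<in> \<Phi> ` carrier M"
      by blast
  qed
  ultimately show ?thesis
    unfolding D_Lie_isomorphic_def by blast
qed

end

text \<open>Follow \<open>p\<close> by the inverse of \<open>q\<close> and test every law after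
  applying the injective map \<open>q\<close>. This avoids proving that the model \<open>N\<close>
  is itself a D-Lie algebra.\<close>

lemma D_Lie_isomorphic_common:
  assumes M: "module (tensor_ring K A) M" and M': "module (tensor_ring K A) M'"
    and br: "\<And>u v. u \<in> carrier M \<Longrightarrow> v \<in> carrier M \<Longrightarrow> bracket M u v \<in> carrier M"
    and br': "\<And>u v. u \<in> carrier M' \<Longrightarrow> v \<in> carrier M' \<Longrightarrow> bracket M' u v \<in> carrier M'"
    and D: "dD M \<in> carrier M" and D': "dD M' \<in> carrier M'"
    and "D_Lie_isomorphic K A M N" "D_Lie_isomorphic K A M' N"
  shows "D_Lie_isomorphic K A M M'"
proof -
  interpret M: module "tensor_ring K A" M by (rule M)
  interpret M': module "tensor_ring K A" M' by (rule M')
  obtain p q where p: "p \<in> D_Lie_hom K A M N" and bij_p: "bij_betw p (carrier M) (carrier N)"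
    and q: "q \<in> D_Lie_hom K A M' N" and bij_q: "bij_betw q (carrier M') (carrier N)"
    using assms(7,8) unfolding D_Lie_isomorphic_def by blast
  define r where "r = inv_into (carrier M') q \<circ> p"
  have bij_r: "bij_betw r (carrier M) (carrier M')"
    unfolding r_def by (rule bij_betw_trans [OF bij_p bij_betw_inv_into [OF bij_q]])
  have r_closed: "r u \<in> carrier M'" if "u \<in> carrier M" for u
    using bij_betw_apply [OF bij_r that] .
  have qr: "q (r u) = p u" if "u \<in> carrier M" for u
    using bij_betw_inv_into_right [OF bij_q bij_betw_apply [OF bij_p that]] by (simp add: r_def)
  \<comment> \<open>Cancellation of \<open>q\<close>: each law for \<open>r\<close> reduces to the
    corresponding laws for \<open>p\<close> and \<open>q\<close> in \<open>N\<close>.\<close>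
  have r_eqI: "r u = v" if "u \<in> carrier M" "v \<in> carrier M'" "p u = q v" for u v
    using bij_q qr [of u] r_closed [of u] that by (auto simp: bij_betw_def dest: inj_onD)
  have "r \<in> D_Lie_hom K A M M'"
    unfolding D_Lie_hom_def lie_mod_hom_def mod_hom_def
  proof (intro CollectI conjI ballI funcsetI)
    fix u v assume uv: "u \<in> carrier M" "v \<in> carrier M"
    show "r (u \<oplus>\<^bsub>M\<^esub> v) = r u \<oplus>\<^bsub>M'\<^esub> r v"
      using p q uv r_closed
      by (intro r_eqI) (simp_all add: D_Lie_hom_def lie_mod_hom_def mod_hom_def qr)
    show "r (bracket M u v) = bracket M' (r u) (r v)"
      using p q uv r_closed br br'
      by (intro r_eqI) (simp_all add: D_Lie_hom_def lie_mod_hom_def qr)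
  next
    fix t u assume "t \<in> carrier (tensor_ring K A)" "u \<in> carrier M"
    then show "r (t \<odot>\<^bsub>M\<^esub> u) = t \<odot>\<^bsub>M'\<^esub> r u"
      using p q r_closed
      by (intro r_eqI) (simp_all add: D_Lie_hom_def lie_mod_hom_def mod_hom_def qr)
  next
    show "r (dD M) = dD M'"
      using p q D D' by (intro r_eqI) (simp_all add: D_Lie_hom_def)
  next
    fix u assume "u \<in> carrier M"
    then show "dpi M u = dpi M' (r u)"
      using p q r_closed [of u] by (simp add: D_Lie_hom_def qr)
  qed (rule r_closed)
  then show ?thesis
    using bij_r unfolding D_Lie_isomorphic_def by blast
qed

theorem theorem1p3:
  fixes K :: "'k ring" and A :: "('k, 'a) module"
    and f :: "('a \<Rightarrow> 'a) \<Rightarrow> ('a \<Rightarrow> 'a) \<Rightarrow> 'a"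
    and M :: "('a, 'l) dlie"
  assumes "algebra K A"
    and "f \<in> lr_Z2 A (Der K A)"
    and "D_Lie_algebra K A f M"
    and "dalpha M (dD M) = (\<one>\<^bsub>A\<^esub>, \<zero>\<^bsub>Der K A\<^esub>)"
    and "projective_module A (canonical_quotient K A M)"
  shows "D_Lie_isomorphic K A M (D_extension A f (canonical_quotient K A M)) \<and>
    (\<forall>f' (M' :: ('a, 'm) dlie).
       f' \<in> lr_Z2 A (Der K A) \<longrightarrow>
       D_Lie_algebra K A f' M' \<longrightarrow>
       dalpha M' (dD M') = (\<one>\<^bsub>A\<^esub>, \<zero>\<^bsub>Der K A\<^esub>) \<longrightarrow>
       lr_H2_class A (Der K A) f' = lr_H2_class A (Der K A) f \<longrightarrow>
       (\<exists>\<theta>. lr_iso A (canonical_quotient K A M) (canonical_quotient K A M') \<theta>) \<longrightarrow>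
       D_Lie_isomorphic K A M M')"
proof -
  interpret tensor_algebra K A
    using assms(1) by (simp add: tensor_algebra_def algebra.M_cring)
  interpret M: d_lie K A f M
    using assms by unfold_locales
  have cochain_closed: "f x y \<in> carrier A"
    if "f \<in> lr_Z2 A (Der K A)" "x \<in> derivations K A" "y \<in> derivations K A" for f x y
    using that by (auto simp: lr_Z2_def lr_C2_def lr_C1_def)
  \<comment> \<open>The zero cochain covers the case where the cocycle does not change.\<close>
  have zero_C1: "(\<lambda>_. \<zero>\<^bsub>A\<^esub>) \<in> lr_C1 A (Der K A)"
    by (simp add: lr_C1_def)
  have zero_d1: "f x y = f x y \<oplus>\<^bsub>A\<^esub> lr_d1 A (Der K A) (\<lambda>_. \<zero>\<^bsub>A\<^esub>) x y"
    if "f \<in> lr_Z2 A (Der K A)" "x \<in> derivations K A" "y \<in> derivations K A" for f x y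
  proof -
    have zero: "z \<zero>\<^bsub>A\<^esub> = \<zero>\<^bsub>A\<^esub>" if "z \<in> derivations K A" for z
      using derivation_diff [OF that, of "\<zero>\<^bsub>A\<^esub>" "\<zero>\<^bsub>A\<^esub>"] derivation_closed [OF that, of "\<zero>\<^bsub>A\<^esub>"]
      by (simp add: a_minus_def A.r_neg)
    show ?thesis
      using that cochain_closed [OF that] zero [OF that(2)] zero [OF that(3)] by (simp add: lr_d1_def a_minus_def)
  qed
  have id: "lr_iso A L L (\<lambda>x. x)" for L :: "('a, 'x) lie_rinehart"
    by (simp add: lr_iso_def lie_mod_hom_def mod_hom_def bij_betw_def)
  have "D_Lie_isomorphic K A M (D_extension A f (canonical_quotient K A M))"
    by (rule M.isomorphic_D_extension [OF M.comm_group_L id cochain_closed [OF assms(2)] zero_C1 zero_d1 [OF assms(2)]])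
  moreover have "D_Lie_isomorphic K A M M'"
    if f': "f' \<in> lr_Z2 A (Der K A)" and D_Lie: "D_Lie_algebra K A f' M'"
      and D: "dalpha M' (dD M') = (\<one>\<^bsub>A\<^esub>, \<zero>\<^bsub>Der K A\<^esub>)"
      and cohom: "lr_H2_class A (Der K A) f' = lr_H2_class A (Der K A) f"
      and \<theta>: "lr_iso A (canonical_quotient K A M) (canonical_quotient K A M') \<theta>"
    for f' \<theta> and M' :: "('a, 'm) dlie"
  proof -
    interpret M': d_lie K A f' M'
      using D_Lie D by unfold_locales
    \<comment> \<open>A cocycle lies in its own class, so equality of the classes puts
      \<open>f'\<close> in the class of \<open>f\<close>, and membership there yields an actual
      cochain \<open>g\<close>.\<close>
    have "f' \<in> lr_H2_class A (Der K A) f'"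
      unfolding lr_H2_class_def using f' zero_C1 zero_d1 [OF f'] by auto
    then obtain g where g: "g \<in> lr_C1 A (Der K A)"
      and f'_eq: "\<And>x y. x \<in> derivations K A \<Longrightarrow> y \<in> derivations K A \<Longrightarrow>
        f' x y = f x y \<oplus>\<^bsub>A\<^esub> lr_d1 A (Der K A) g x y"
      unfolding cohom by (auto simp: lr_H2_class_def)
    \<comment> \<open>The common model belongs to \<open>M'\<close>: \<open>M\<close> reaches it
      through \<open>\<theta>\<close> and \<open>g\<close>, and \<open>M'\<close> through the
      identity and the zero cochain.\<close>
    have "D_Lie_isomorphic K A M (D_extension A f' (canonical_quotient K A M'))"
      by (rule M.isomorphic_D_extension [OF M'.comm_group_L \<theta> cochain_closed [OF assms(2)] g f'_eq])
    moreover have "D_Lie_isomorphic K A M' (D_extension A f' (canonical_quotient K A M'))"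
      by (rule M'.isomorphic_D_extension [OF M'.comm_group_L id cochain_closed [OF f'] zero_C1 zero_d1 [OF f']])
    ultimately show ?thesis
      by (intro D_Lie_isomorphic_common [OF M.M.module_axioms M'.M.module_axioms]) simp_all
  qed
  ultimately show ?thesis
    by blast
qed

end
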